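(* Let $p>1$, let $[X,\mathcal B,m^i,\nu_i]$ ($i=1,2$) be reversible random walk spaces on the same measurable space with $\nu_2\ll\nu_1$, $\mu=\frac{d\nu_2}{d\nu_1}\in L^\infty(X,\nu_1)$, $\mu\ge c>0$ $\nu_1$-a.e., and $\nu_1(X)<\infty$. Assume $\mathcal F_{1,m^1}$ satisfies a $1$-Poincaré inequality with constant $\lambda_1(\mathcal F_{1,m^1})>0$. For $u_0\in L^2(X,\nu_1)$ let $u$ be the strong solution of $u_t-\Delta_1^{m^1}u-\mu\Delta_p^{m^2}u\ni0$, $u(0)=u_0$. Then $$\|u(t)-\overline{u_0}\|_{L^1(X,\nu_1)}\le\frac{1}{2\lambda_1(\mathcal F_{1,m^1})}\,\frac{\|u_0\|^2_{L^2(X,\nu_1)}}{t}\qquad\forall t>0.$$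
   Context: Random walk space $[X,\mathcal B,m,\nu]$: measurable space with countably generated $\sigma$-algebra, probability measures $m_x$ depending measurably on $x$, $\sigma$-finite invariant measure $\nu$ ($\nu(A)=\int m_x(A)\,d\nu(x)$), reversible if $dm_x(y)d\nu(x)=dm_y(x)d\nu(y)$. $\nabla u(x,y)=u(y)-u(x)$. $\mathcal F_{1,m^1}(u)=\frac12\int_{X\times X}|\nabla u|\,dm^1_x(y)d\nu_1(x)$ ($+\infty$ if infinite). $\overline{u}=\frac1{\nu_1(X)}\int_X u\,d\nu_1$. $\mathcal F_{1,m^1}$ satisfies an $r$-Poincaré inequality ($1\le r<\infty$) if there is $\lambda_r(\mathcal F_{1,m^1})>0$ with $\lambda_r\|u-\overline u\|_{L^r(X,\nu_1)}\le\mathcal F_{1,m^1}(u)$ for all $u\in L^r(X,\nu_1)$. $(u,v)\in\Delta_1^{m}$ iff $(u,-v)\in\partial_{L^2(X,\nu)}\mathcal F_{1,m}(u)$ (convex subdifferential). For $p>1$, $(u,w)\in\Delta_p^{m}$ iff $u,w\in L^2(X,\nu)$, $\nabla u\in L^p(dm_x(y)d\nu(x))$ and $w(x)=\int_X|\nabla u(x,y)|^{p-2}\nabla u(x,y)\,dm_x(y)$. The operator $A=-\Delta_1^{m^1}-\mu\Delta_p^{m^2}$ on $H=L^2(X,\nu_1)$: $(u,v)\in A$ iff $u,v\in H$, $v=v_1-\mu w$ with $(u,-v_1)\in\Delta_1^{m^1}$ (w.r.t. $\nu_1$) and $(u,w)\in\Delta_p^{m^2}$ (w.r.t. $\nu_2$).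 Strong solution: $u\in C([0,\infty);H)\cap W^{1,2}_{\rm loc}(0,\infty;H)$, $u(0)=u_0$, $-u_t(t)\in A(u(t))$ for a.e. $t$. *)

theory Defs
  imports "HOL-Analysis.Analysis" "HOL-Probability.Probability"
begin

definition countably_generated :: "'a measure \<Rightarrow> bool" where
  "countably_generated M \<longleftrightarrow>
     (\<exists>C. countable C \<and> C \<subseteq> Pow (space M) \<and> sets M = sigma_sets (space M) C)"

definition rw_space :: "'a measure \<Rightarrow> ('a \<Rightarrow> 'a measure) \<Rightarrow> 'a measure \<Rightarrow> bool" where
  "rw_space M m \<nu> \<longleftrightarrow>
     countably_generated M \<and>
     (\<forall>x\<in>space M. prob_space (m x) \<and> sets (m x) = sets M) \<and>
     (\<forall>A\<in>sets M. (\<lambda>x. emeasure (m x) A) \<in> borel_measurable M) \<and>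
     sets \<nu> = sets M \<and> sigma_finite_measure \<nu> \<and>
     (\<forall>A\<in>sets M. emeasure \<nu> A = (\<integral>\<^sup>+ x. emeasure (m x) A \<partial>\<nu>))"

text \<open>Reversibility dm_x(y) dnu(x) = dm_y(x) dnu(y), tested on measurable rectangles A x B.\<close>
definition reversible_rw :: "'a measure \<Rightarrow> ('a \<Rightarrow> 'a measure) \<Rightarrow> 'a measure \<Rightarrow> bool" where
  "reversible_rw M m \<nu> \<longleftrightarrow>
     (\<forall>A\<in>sets M. \<forall>B\<in>sets M.
        (\<integral>\<^sup>+ x. indicator A x * emeasure (m x) B \<partial>\<nu>) =
        (\<integral>\<^sup>+ x. indicator B x * emeasure (m x) A \<partial>\<nu>))"

definition L2 :: "'a measure \<Rightarrow> ('a \<Rightarrow> real) \<Rightarrow> bool" where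
  "L2 \<nu> u \<longleftrightarrow> u \<in> borel_measurable \<nu> \<and> integrable \<nu> (\<lambda>x. (u x)\<^sup>2)"

definition L2norm :: "'a measure \<Rightarrow> ('a \<Rightarrow> real) \<Rightarrow> real" where
  "L2norm \<nu> u = sqrt (\<integral>x. (u x)\<^sup>2 \<partial>\<nu>)"

definition mean :: "'a measure \<Rightarrow> ('a \<Rightarrow> real) \<Rightarrow> real" where
  "mean \<nu> u = (\<integral>x. u x \<partial>\<nu>) / measure \<nu> (space \<nu>)"

definition F1 :: "('a \<Rightarrow> 'a measure) \<Rightarrow> 'a measure \<Rightarrow> ('a \<Rightarrow> real) \<Rightarrow> ennreal" where
  "F1 m \<nu> u = (1/2) * (\<integral>\<^sup>+ x. (\<integral>\<^sup>+ y. ennreal \<bar>u y - u x\<bar> \<partial>(m x)) \<partial>\<nu>)"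

definition subdiffL2 :: "'a measure \<Rightarrow> (('a \<Rightarrow> real) \<Rightarrow> ennreal) \<Rightarrow> ('a \<Rightarrow> real) \<Rightarrow> ('a \<Rightarrow> real) \<Rightarrow> bool" where
  "subdiffL2 \<nu> F u v \<longleftrightarrow> L2 \<nu> u \<and> L2 \<nu> v \<and> F u < \<infinity> \<and>
     (\<forall>z. L2 \<nu> z \<longrightarrow>
        enn2ereal (F u) + ereal (\<integral>x. v x * (z x - u x) \<partial>\<nu>) \<le> enn2ereal (F z))"

definition Delta1 :: "('a \<Rightarrow> 'a measure) \<Rightarrow> 'a measure \<Rightarrow> ('a \<Rightarrow> real) \<Rightarrow> ('a \<Rightarrow> real) \<Rightarrow> bool" where
  "Delta1 m \<nu> u v \<longleftrightarrow> subdiffL2 \<nu> (F1 m \<nu>) u (\<lambda>x. - v x)"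

text \<open>|d|^{p-2} d (with value 0 at d = 0).\<close>
definition spow :: "real \<Rightarrow> real \<Rightarrow> real" where
  "spow p d = sgn d * \<bar>d\<bar> powr (p - 1)"

definition Deltap :: "real \<Rightarrow> ('a \<Rightarrow> 'a measure) \<Rightarrow> 'a measure \<Rightarrow> ('a \<Rightarrow> real) \<Rightarrow> ('a \<Rightarrow> real) \<Rightarrow> bool" where
  "Deltap p m \<nu> u w \<longleftrightarrow> L2 \<nu> u \<and> L2 \<nu> w \<and>
     (\<integral>\<^sup>+ x. (\<integral>\<^sup>+ y. ennreal (\<bar>u y - u x\<bar> powr p) \<partial>(m x)) \<partial>\<nu>) < \<infinity> \<and>
     (AE x in \<nu>. w x = (\<integral>y. spow p (u y - u x) \<partial>(m x)))"

definition opA :: "real \<Rightarrow> ('a \<Rightarrow> 'a measure) \<Rightarrow> 'a measure \<Rightarrow> ('a \<Rightarrow> 'a measure) \<Rightarrow> 'a measure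
                   \<Rightarrow> ('a \<Rightarrow> real) \<Rightarrow> ('a \<Rightarrow> real) \<Rightarrow> ('a \<Rightarrow> real) \<Rightarrow> bool" where
  "opA p m1 \<nu>1 m2 \<nu>2 \<mu> u v \<longleftrightarrow> L2 \<nu>1 u \<and> L2 \<nu>1 v \<and>
     (\<exists>v1 w. Delta1 m1 \<nu>1 u (\<lambda>x. - v1 x) \<and> Deltap p m2 \<nu>2 u w \<and>
             (AE x in \<nu>1. v x = v1 x - \<mu> x * w x))"

text \<open>Strong solution: u \<in> C([0,\<infinity>);H) \<inter> W^{1,2}_loc(0,\<infinity>;H), u(0) = u0, -u_t(t) \<in> A(u(t)) a.e.
  The H-valued weak derivative is represented by a jointly measurable function ut on
  (0,\<infinity>) \<times> X, locally square integrable, with u(t) - u(s) = \<integral>_s^t ut(r) dr.\<close>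
definition strong_solution :: "real \<Rightarrow> ('a \<Rightarrow> 'a measure) \<Rightarrow> 'a measure \<Rightarrow> ('a \<Rightarrow> 'a measure) \<Rightarrow> 'a measure
                   \<Rightarrow> ('a \<Rightarrow> real) \<Rightarrow> ('a \<Rightarrow> real) \<Rightarrow> (real \<Rightarrow> 'a \<Rightarrow> real) \<Rightarrow> bool" where
  "strong_solution p m1 \<nu>1 m2 \<nu>2 \<mu> u0 u \<longleftrightarrow>
     (\<forall>t\<ge>0. L2 \<nu>1 (u t)) \<and>
     (\<forall>t\<ge>0. ((\<lambda>s. L2norm \<nu>1 (\<lambda>x. u s x - u t x)) \<longlongrightarrow> 0) (at t within {0..})) \<and>
     (AE x in \<nu>1. u 0 x = u0 x) \<and>
     (\<exists>ut :: real \<Rightarrow> 'a \<Rightarrow> real.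
        (\<lambda>(t, x). ut t x) \<in> borel_measurable (lborel \<Otimes>\<^sub>M \<nu>1) \<and>
        (\<forall>a b. 0 < a \<longrightarrow> a \<le> b \<longrightarrow>
           (\<integral>\<^sup>+ t. indicator {a..b} t * (\<integral>\<^sup>+ x. ennreal ((ut t x)\<^sup>2) \<partial>\<nu>1) \<partial>lborel) < \<infinity>) \<and>
        (\<forall>s t. 0 < s \<longrightarrow> s \<le> t \<longrightarrow>
           (AE x in \<nu>1. u t x - u s x = (LINT r:{s..t}|lborel. ut r x))) \<and>
        (AE t in lborel. 0 < t \<longrightarrow> opA p m1 \<nu>1 m2 \<nu>2 \<mu> (u t) (\<lambda>x. - ut t x)))"

end

theory Submission
  imports Defs
begin

text \<open>
  Pairing \<open>u\<^sub>t\<close> with \<open>T(u)\<close>, for a nondecreasing \<open>T\<close> of Lipschitz constant at most one, is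
  dissipative: for the 1-Laplacian part the subgradient inequality is tested at \<open>u - T(u)\<close>,
  whose total variation does not exceed that of \<open>u\<close>; for the p-Laplacian part reversibility
  symmetrises the double integral. Constant \<open>T\<close> gives conservation of mass, truncations give
  monotonicity of the \<open>L\<^sup>1\<close> distance to the mean in time, and \<open>T(u) = u\<close> gives
  \<open>d/dt \<parallel>u\<parallel>\<^sup>2 / 2 \<le> - F\<^sub>1(u)\<close>. By the Poincare inequality and the monotonicity, \<open>F\<^sub>1(u(r))\<close> is at least
  \<open>\<lambda>\<^sub>1\<close> times the \<open>L\<^sup>1\<close> distance at the final time \<open>t\<close> for all \<open>r \<le> t\<close>; integrate over \<open>[0, t]\<close>.
\<close>

section \<open>Integration over kernels and the measure m_x(dy) \<nu>(dx) on pairs\<close>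

lemma nn_integral_kernel_measurable:
  assumes "K \<in> measurable N (subprob_algebra B)" "f \<in> borel_measurable B"
  shows "(\<lambda>x. \<integral>\<^sup>+y. f y \<partial>K x) \<in> borel_measurable N"
  by (rule measurable_compose[OF assms(1) nn_integral_measurable_subprob_algebra[OF assms(2)]])

text \<open>Fubini for a signed integrand. \<open>nn_integral_bind\<close> applies to the positive
  part, the negative part and the norm of \<open>f\<close>; all three iterated integrals are finite.
  Hence for almost every \<open>x\<close> the inner integral is a difference of two finite
  nonnegative integrals, and this difference can be integrated over \<open>N\<close>.\<close>

lemma integral_bind_kernel:
  fixes f :: "'b \<Rightarrow> real"
  assumes K[measurable]: "K \<in> measurable N (subprob_algebra B)"
    and fB[measurable]: "f \<in> borel_measurable B"
    and f: "integrable (N \<bind> K) f"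
  shows "AE x in N. integrable (K x) f"
    and "integrable N (\<lambda>x. \<integral>y. f y \<partial>K x)"
    and "(\<integral>z. f z \<partial>(N \<bind> K)) = (\<integral>x. (\<integral>y. f y \<partial>K x) \<partial>N)"
proof -
  \<comment> \<open>\<open>ennreal\<close> sends negative reals to 0, so these are the integrals of
    the positive and of the negative part of \<open>f\<close>.\<close>
  let ?P = "\<lambda>x. \<integral>\<^sup>+y. ennreal (f y) \<partial>K x" and ?Q = "\<lambda>x. \<integral>\<^sup>+y. ennreal (- f y) \<partial>K x"
  have [measurable]: "?P \<in> borel_measurable N" "?Q \<in> borel_measurable N"
    "(\<lambda>x. \<integral>\<^sup>+y. ennreal (norm (f y)) \<partial>K x) \<in> borel_measurable N"
    by (auto intro!: nn_integral_kernel_measurable[OF K])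
  have P: "(\<integral>\<^sup>+x. ?P x \<partial>N) = (\<integral>\<^sup>+z. f z \<partial>(N \<bind> K))"
    and Q: "(\<integral>\<^sup>+x. ?Q x \<partial>N) = (\<integral>\<^sup>+z. ennreal (- f z) \<partial>(N \<bind> K))"
    and A: "(\<integral>\<^sup>+x. (\<integral>\<^sup>+y. ennreal (norm (f y)) \<partial>K x) \<partial>N) = (\<integral>\<^sup>+z. ennreal (norm (f z)) \<partial>(N \<bind> K))"
    by (auto intro!: nn_integral_bind[symmetric, OF _ K])
  have PF: "(\<integral>\<^sup>+x. ?P x \<partial>N) < \<infinity>" and QF: "(\<integral>\<^sup>+x. ?Q x \<partial>N) < \<infinity>"
    using f unfolding P Q real_integrable_def by (auto simp: less_top)
  have "(\<integral>\<^sup>+x. (\<integral>\<^sup>+y. ennreal (norm (f y)) \<partial>K x) \<partial>N) \<noteq> \<infinity>"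
    using f unfolding A integrable_iff_bounded by auto
  then have AF: "AE x in N. (\<integral>\<^sup>+y. ennreal (norm (f y)) \<partial>K x) \<noteq> \<infinity>"
    by (intro nn_integral_PInf_AE) auto
  show ae: "AE x in N. integrable (K x) f"
    using AF AE_space
  proof eventually_elim
    case (elim x)
    have "f \<in> borel_measurable (K x)"
      using fB measurable_cong_sets[OF sets_kernel[OF K elim(2)] refl] by blast
    then show ?case using elim by (auto simp: integrable_iff_bounded less_top)
  qed
  have PA: "AE x in N. ?P x \<noteq> \<infinity>" and QA: "AE x in N. ?Q x \<noteq> \<infinity>"
    using nn_integral_PInf_AE[of ?P N] nn_integral_PInf_AE[of ?Q N] PF QF by auto
  have rP: "(\<integral>\<^sup>+x. ennreal (enn2real (?P x)) \<partial>N) = (\<integral>\<^sup>+x. ?P x \<partial>N)"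
    by (rule nn_integral_cong_AE) (use PA in eventually_elim, auto simp: less_top)
  have rQ: "(\<integral>\<^sup>+x. ennreal (enn2real (?Q x)) \<partial>N) = (\<integral>\<^sup>+x. ?Q x \<partial>N)"
    by (rule nn_integral_cong_AE) (use QA in eventually_elim, auto simp: less_top)
  have iP: "integrable N (\<lambda>x. enn2real (?P x))" and iQ: "integrable N (\<lambda>x. enn2real (?Q x))"
    using PF QF rP rQ by (auto intro!: integrableI_nonneg)
  have eq: "AE x in N. (\<integral>y. f y \<partial>K x) = enn2real (?P x) - enn2real (?Q x)"
    using ae by eventually_elim (rule real_lebesgue_integral_def)
  have m: "(\<lambda>x. \<integral>y. f y \<partial>K x) \<in> borel_measurable N"
    by (rule measurable_compose[OF K integral_measurable_subprob_algebra[OF fB]])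
  show "integrable N (\<lambda>x. \<integral>y. f y \<partial>K x)"
    by (subst integrable_cong_AE[OF m _ eq]) (use iP iQ in auto)
  have "(\<integral>x. (\<integral>y. f y \<partial>K x) \<partial>N) = (\<integral>x. enn2real (?P x) - enn2real (?Q x) \<partial>N)"
    by (rule integral_cong_AE[OF m _ eq]) auto
  also have "\<dots> = (\<integral>x. enn2real (?P x) \<partial>N) - (\<integral>x. enn2real (?Q x) \<partial>N)"
    using iP iQ by simp
  also have "\<dots> = enn2real (\<integral>\<^sup>+x. ?P x \<partial>N) - enn2real (\<integral>\<^sup>+x. ?Q x \<partial>N)"
    by (simp add: integral_eq_nn_integral rP rQ)
  also have "\<dots> = (\<integral>z. f z \<partial>(N \<bind> K))"
    unfolding P Q by (rule real_lebesgue_integral_def[OF f, symmetric])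
  finally show "(\<integral>z. f z \<partial>(N \<bind> K)) = (\<integral>x. (\<integral>y. f y \<partial>K x) \<partial>N)" by simp
qed

definition edge_kernel :: "('a \<Rightarrow> 'a measure) \<Rightarrow> 'a measure \<Rightarrow> 'a \<Rightarrow> ('a \<times> 'a) measure" where
  "edge_kernel m \<nu> x = distr (m x) (\<nu> \<Otimes>\<^sub>M \<nu>) (Pair x)"

text \<open>The kernel is the point mass at \<open>x\<close> times \<open>m x\<close>, so this is
  m_x(dy) \<nu>(dx). As one measure on pairs it lets reversibility be stated as invariance under the
  swap of coordinates.\<close>

definition edge_measure :: "('a \<Rightarrow> 'a measure) \<Rightarrow> 'a measure \<Rightarrow> ('a \<times> 'a) measure" where
  "edge_measure m \<nu> = \<nu> \<bind> edge_kernel m \<nu>"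

context
  fixes M \<nu> :: "'a measure" and m :: "'a \<Rightarrow> 'a measure"
  assumes rw: "rw_space M m \<nu>"
begin

lemma rw_sets: "sets \<nu> = sets M" and rw_space_eq: "space \<nu> = space M"
  using rw sets_eq_imp_space_eq[of \<nu> M] by (simp_all add: rw_space_def)

lemma rw_step:
  assumes "x \<in> space \<nu>"
  shows "prob_space (m x)" "sets (m x) = sets \<nu>" "space (m x) = space \<nu>"
  using rw assms sets_eq_imp_space_eq[of "m x" \<nu>] by (simp_all add: rw_space_def rw_space_eq)

lemma rw_kernel_measurable: "m \<in> measurable \<nu> (subprob_algebra \<nu>)"
proof (rule measurable_subprob_algebra)
  fix A assume "A \<in> sets \<nu>"
  then show "(\<lambda>a. emeasure (m a) A) \<in> borel_measurable \<nu>"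
    using rw measurable_cong_sets[OF rw_sets refl] by (auto simp: rw_space_def)
qed (simp_all add: prob_space_imp_subprob_space rw_step)

lemma edge_kernel_measurable: "edge_kernel m \<nu> \<in> measurable \<nu> (subprob_algebra (\<nu> \<Otimes>\<^sub>M \<nu>))"
  unfolding edge_kernel_def[abs_def]
  by (rule measurable_distr2[OF _ rw_kernel_measurable]) (simp add: case_prod_Pair)

lemma rw_Pair_measurable:
  "x \<in> space \<nu> \<Longrightarrow> Pair x \<in> measurable (m x) (\<nu> \<Otimes>\<^sub>M \<nu>)"
  using measurable_cong_sets[OF rw_step(2) refl, of x "\<nu> \<Otimes>\<^sub>M \<nu>"] measurable_Pair1'[of x \<nu> \<nu>] by simp

lemma nn_integral_edge_measure:
  assumes f: "f \<in> borel_measurable (\<nu> \<Otimes>\<^sub>M \<nu>)"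
  shows "(\<integral>\<^sup>+z. f z \<partial>edge_measure m \<nu>) = (\<integral>\<^sup>+x. (\<integral>\<^sup>+y. f (x, y) \<partial>m x) \<partial>\<nu>)"
  unfolding edge_measure_def nn_integral_bind[OF f edge_kernel_measurable]
  by (rule nn_integral_cong)
     (simp add: edge_kernel_def nn_integral_distr[OF rw_Pair_measurable] f)

lemma integral_edge_measure:
  fixes f :: "'a \<times> 'a \<Rightarrow> real"
  assumes f: "f \<in> borel_measurable (\<nu> \<Otimes>\<^sub>M \<nu>)" and i: "integrable (edge_measure m \<nu>) f"
  shows "integrable \<nu> (\<lambda>x. \<integral>y. f (x, y) \<partial>m x)"
    and "(\<integral>z. f z \<partial>edge_measure m \<nu>) = (\<integral>x. (\<integral>y. f (x, y) \<partial>m x) \<partial>\<nu>)"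
proof -
  note bind = integral_bind_kernel(2,3)[OF edge_kernel_measurable f i[unfolded edge_measure_def]]
  have eq: "(\<integral>z. f z \<partial>edge_kernel m \<nu> x) = (\<integral>y. f (x, y) \<partial>m x)" if "x \<in> space \<nu>" for x
    by (simp add: edge_kernel_def integral_distr[OF rw_Pair_measurable] f that)
  show "integrable \<nu> (\<lambda>x. \<integral>y. f (x, y) \<partial>m x)"
    by (rule iffD1[OF Bochner_Integration.integrable_cong[OF refl eq] bind(1)])
  show "(\<integral>z. f z \<partial>edge_measure m \<nu>) = (\<integral>x. (\<integral>y. f (x, y) \<partial>m x) \<partial>\<nu>)"
    unfolding edge_measure_def bind(2) by (rule Bochner_Integration.integral_cong) (simp_all add: eq)
qed

text \<open>On an empty space \<open>bind\<close> degenerates to \<open>count_space {}\<close>,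
  hence the nonemptiness hypothesis here and in the lemmas that build on it.\<close>

lemma sets_edge_measure: "space \<nu> \<noteq> {} \<Longrightarrow> sets (edge_measure m \<nu>) = sets (\<nu> \<Otimes>\<^sub>M \<nu>)"
  unfolding edge_measure_def by (rule sets_bind_measurable[OF edge_kernel_measurable])

lemma emeasure_edge_measure_Times:
  assumes "space \<nu> \<noteq> {}" "A \<in> sets \<nu>" "B \<in> sets \<nu>"
  shows "emeasure (edge_measure m \<nu>) (A \<times> B) = (\<integral>\<^sup>+x. indicator A x * emeasure (m x) B \<partial>\<nu>)"
proof -
  have "emeasure (edge_measure m \<nu>) (A \<times> B) = (\<integral>\<^sup>+z. indicator (A \<times> B) z \<partial>edge_measure m \<nu>)"
    using assms by (intro nn_integral_indicator[symmetric]) (simp add: sets_edge_measure)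
  also have "\<dots> = (\<integral>\<^sup>+x. (\<integral>\<^sup>+y. indicator (A \<times> B) (x, y) \<partial>m x) \<partial>\<nu>)"
    using assms by (intro nn_integral_edge_measure) simp
  also have "\<dots> = (\<integral>\<^sup>+x. indicator A x * emeasure (m x) B \<partial>\<nu>)"
    using assms by (intro nn_integral_cong) (simp add: indicator_times nn_integral_cmult_indicator rw_step)
  finally show ?thesis .
qed

lemma emeasure_edge_measure_space:
  assumes ne: "space \<nu> \<noteq> {}"
  shows "emeasure (edge_measure m \<nu>) (space \<nu> \<times> space \<nu>) = emeasure \<nu> (space \<nu>)"
proof -
  have "emeasure (m x) (space \<nu>) = 1" if "x \<in> space \<nu>" for x
    using prob_space.emeasure_space_1[OF rw_step(1)[OF that]] that by (simp add: rw_step(3))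
  then have "emeasure (edge_measure m \<nu>) (space \<nu> \<times> space \<nu>) = (\<integral>\<^sup>+x. 1 \<partial>\<nu>)"
    unfolding emeasure_edge_measure_Times[OF ne sets.top sets.top]
    by (intro nn_integral_cong) simp
  then show ?thesis by simp
qed

text \<open>Reversibility gives the equality on rectangles. These form an intersection-stable
  generator of the product sigma-algebra, and the total mass is finite because each
  \<open>m x\<close> has mass 1, so the two measures coincide.\<close>

lemma edge_measure_swap:
  assumes ne: "space \<nu> \<noteq> {}" and fin: "emeasure \<nu> (space \<nu>) < \<infinity>" and rev: "reversible_rw M m \<nu>"
  shows "distr (edge_measure m \<nu>) (\<nu> \<Otimes>\<^sub>M \<nu>) (\<lambda>(x, y). (y, x)) = edge_measure m \<nu>"
proof -
  let ?J = "edge_measure m \<nu>" and ?E = "{A \<times> B | A B. A \<in> sets \<nu> \<and> B \<in> sets \<nu>}"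
  have J[measurable_cong]: "sets ?J = sets (\<nu> \<Otimes>\<^sub>M \<nu>)" by (rule sets_edge_measure[OF ne])
  have sp: "space ?J = space \<nu> \<times> space \<nu>"
    using sets_eq_imp_space_eq[OF J] by (simp add: space_pair_measure)
  have T: "emeasure ?J (A \<times> B) = emeasure ?J (B \<times> A)" if "A \<in> sets \<nu>" "B \<in> sets \<nu>" for A B
    using rev that by (simp add: emeasure_edge_measure_Times[OF ne] reversible_rw_def rw_sets)
  have "?J = distr ?J (\<nu> \<Otimes>\<^sub>M \<nu>) (\<lambda>(x, y). (y, x))"
  proof (rule measure_eqI_generator_eq[where E = ?E and \<Omega> = "space \<nu> \<times> space \<nu>"
        and A = "\<lambda>_. space \<nu> \<times> space \<nu>"])
    show "Int_stable ?E" by (rule Int_stable_pair_measure_generator)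
    show "?E \<subseteq> Pow (space \<nu> \<times> space \<nu>)" by (rule pair_measure_closed)
    show "sets ?J = sigma_sets (space \<nu> \<times> space \<nu>) ?E"
      by (simp add: J sets_pair_measure)
    show "sets (distr ?J (\<nu> \<Otimes>\<^sub>M \<nu>) (\<lambda>(x, y). (y, x))) = sigma_sets (space \<nu> \<times> space \<nu>) ?E"
      by (simp add: sets_pair_measure)
    fix X assume "X \<in> ?E"
    then obtain A B where X: "X = A \<times> B" and AB: "A \<in> sets \<nu>" "B \<in> sets \<nu>" by auto
    have "(\<lambda>(x, y). (y, x)) -` X \<inter> space ?J = B \<times> A"
      using AB[THEN sets.sets_into_space] by (auto simp: X sp)
    then show "emeasure ?J X = emeasure (distr ?J (\<nu> \<Otimes>\<^sub>M \<nu>) (\<lambda>(x, y). (y, x))) X"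
      using AB by (subst emeasure_distr) (auto simp: X T)
  next
    show "emeasure ?J (space \<nu> \<times> space \<nu>) \<noteq> \<infinity>"
      using fin by (simp add: emeasure_edge_measure_space[OF ne])
  qed auto
  then show ?thesis by simp
qed

end

section \<open>Square-integrable functions\<close>

lemma L2_measurable: "L2 \<nu> f \<Longrightarrow> f \<in> borel_measurable \<nu>"
  by (simp add: L2_def)

lemma L2_mult_integrable:
  assumes "L2 \<nu> f" "L2 \<nu> g"
  shows "integrable \<nu> (\<lambda>x. f x * g x)"
proof (rule Bochner_Integration.integrable_bound)
  show "integrable \<nu> (\<lambda>x. (f x)\<^sup>2 + (g x)\<^sup>2)" using assms by (simp add: L2_def)
  show "(\<lambda>x. f x * g x) \<in> borel_measurable \<nu>"
    using assms by (intro borel_measurable_times) (simp_all add: L2_def)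
  have "\<bar>a * b\<bar> \<le> a\<^sup>2 + b\<^sup>2" for a b :: real
    using sum_squares_bound[of "\<bar>a\<bar>" "\<bar>b\<bar>"] abs_ge_zero[of "a * b"]
    by (simp only: abs_mult power2_abs mult.assoc)
  then show "AE x in \<nu>. norm (f x * g x) \<le> norm ((f x)\<^sup>2 + (g x)\<^sup>2)" by simp
qed

lemma L2_add:
  assumes "L2 \<nu> f" "L2 \<nu> g"
  shows "L2 \<nu> (\<lambda>x. f x + g x)"
  using assms L2_mult_integrable[OF assms]
  by (auto simp: L2_def power2_sum mult.assoc)

lemma L2_uminus: "L2 \<nu> f \<Longrightarrow> L2 \<nu> (\<lambda>x. - f x)"
  by (simp add: L2_def)

lemma L2_diff:
  assumes "L2 \<nu> f" "L2 \<nu> g"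
  shows "L2 \<nu> (\<lambda>x. f x - g x)"
  using L2_add[OF assms(1) L2_uminus[OF assms(2)]] by simp

lemma L2_mono_bound:
  assumes "L2 \<nu> f" "g \<in> borel_measurable \<nu>" "\<And>x. \<bar>g x\<bar> \<le> \<bar>f x\<bar>"
  shows "L2 \<nu> g"
  unfolding L2_def
proof
  show "integrable \<nu> (\<lambda>x. (g x)\<^sup>2)"
  proof (rule Bochner_Integration.integrable_bound)
    show "integrable \<nu> (\<lambda>x. (f x)\<^sup>2)" using assms(1) by (simp add: L2_def)
    show "(\<lambda>x. (g x)\<^sup>2) \<in> borel_measurable \<nu>" using assms(2) by simp
    show "AE x in \<nu>. norm ((g x)\<^sup>2) \<le> norm ((f x)\<^sup>2)"
      using assms(3) abs_le_square_iff by auto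
  qed
qed fact

lemma (in finite_measure) L2_bounded:
  assumes "g \<in> borel_measurable M" "\<And>x. \<bar>g x\<bar> \<le> K"
  shows "L2 M g"
proof (rule L2_mono_bound)
  show "L2 M (\<lambda>_. K)" by (simp add: L2_def)
  show "\<bar>g x\<bar> \<le> \<bar>K\<bar>" for x using assms(2)[of x] by linarith
qed fact

lemma (in finite_measure) L2_integrable: "L2 M f \<Longrightarrow> integrable M f"
  using L2_mult_integrable[of M f "\<lambda>_. 1"] by (simp add: L2_def)

section \<open>Dissipativity of the p-Laplacian\<close>

lemma spow_minus: "spow p (- d) = - spow p d"
  by (simp add: spow_def sgn_minus)

lemma spow_measurable[measurable]: "spow p \<in> borel_measurable borel"
  unfolding spow_def[abs_def] sgn_real_def by measurable

text \<open>Compare powers separately for increments below and above 1. On a finite measure this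
  makes the flux integrable as soon as the p-th power of the gradient is.\<close>

lemma abs_spow_le:
  assumes "p > 1"
  shows "\<bar>spow p d\<bar> \<le> 1 + \<bar>d\<bar> powr p"
proof -
  have "\<bar>d\<bar> powr (p - 1) \<le> 1 + \<bar>d\<bar> powr p"
  proof (cases "\<bar>d\<bar> \<le> 1")
    case True
    then have "\<bar>d\<bar> powr (p - 1) \<le> 1" using assms by (intro powr_le1) auto
    then show ?thesis by (simp add: add_increasing2)
  next
    case False
    then have "\<bar>d\<bar> powr (p - 1) \<le> \<bar>d\<bar> powr p" by (intro powr_mono) auto
    then show ?thesis by simp
  qed
  then show ?thesis
    by (cases "d = 0") (auto simp: spow_def abs_mult abs_sgn_eq)
qed

text \<open>The first factor has the sign of \<open>b - a\<close>, the second the opposite sign or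
  value 0.\<close>

lemma spow_mult_mono_le:
  assumes "mono T"
  shows "spow p (b - a) * (T a - T b) \<le> (0::real)"
proof (cases "a \<le> b")
  case True
  then show ?thesis
    using monoD[OF assms True] by (intro mult_nonneg_nonpos) (auto simp: spow_def sgn_real_def)
next
  case False
  then show ?thesis
    using monoD[OF assms, of b a] by (intro mult_nonpos_nonneg) (auto simp: spow_def sgn_real_def)
qed

text \<open>The pairing is the integral of \<open>?h\<close> over the edge measure. By swap
  invariance \<open>?h\<close> may be averaged with its reflection; as \<open>spow\<close> is odd,
  the sum of the two is \<open>spow p (u y - u x) * (T (u x) - T (u y))\<close>, which is never
  positive. The bound on \<open>T\<close> makes \<open>?h\<close> integrable.\<close>

lemma Deltap_dissipation_bounded:
  assumes p: "p > 1" and rw: "rw_space M m \<nu>" and rev: "reversible_rw M m \<nu>"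
    and fin: "emeasure \<nu> (space \<nu>) < \<infinity>" and D: "Deltap p m \<nu> u w"
    and T: "mono T" and K: "\<And>a. \<bar>T a\<bar> \<le> K"
  shows "(\<integral>x. w x * T (u x) \<partial>\<nu>) \<le> 0"
proof (cases "space \<nu> = {}")
  case True
  then have "(\<integral>x. w x * T (u x) \<partial>\<nu>) = (\<integral>x. 0 \<partial>\<nu>)"
    by (intro Bochner_Integration.integral_cong) auto
  then show ?thesis by simp
next
  case ne: False
  let ?J = "edge_measure m \<nu>" and ?d = "\<lambda>(x, y). u y - u x"
  let ?h = "\<lambda>(x, y). spow p (u y - u x) * T (u x)"
  have [measurable]: "u \<in> borel_measurable \<nu>" "w \<in> borel_measurable \<nu>"
    using D by (auto simp: Deltap_def L2_def)
  have [measurable]: "T \<in> borel_measurable borel" by (rule borel_measurable_mono[OF T])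
  have J[measurable_cong]: "sets ?J = sets (\<nu> \<Otimes>\<^sub>M \<nu>)" by (rule sets_edge_measure[OF rw ne])
  have sp: "space ?J = space \<nu> \<times> space \<nu>"
    using sets_eq_imp_space_eq[OF J] by (simp add: space_pair_measure)
  interpret J: finite_measure ?J
    using fin by (intro finite_measureI) (simp add: sp emeasure_edge_measure_space[OF rw ne])
  have "(\<integral>\<^sup>+z. ennreal (\<bar>?d z\<bar> powr p) \<partial>?J) < \<infinity>"
    using D by (subst nn_integral_edge_measure[OF rw]) (auto simp: Deltap_def)
  then have dp: "integrable ?J (\<lambda>z. \<bar>?d z\<bar> powr p)"
    by (intro integrableI_nonneg) auto
  have K0: "0 \<le> K" using K[of 0] by linarith
  have h: "integrable ?J ?h"
  proof (rule Bochner_Integration.integrable_bound)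
    show "integrable ?J (\<lambda>z. (1 + \<bar>?d z\<bar> powr p) * K)" using dp by auto
    show "AE z in ?J. norm (?h z) \<le> norm ((1 + \<bar>?d z\<bar> powr p) * K)"
      using K0 by (intro AE_I2)
        (auto simp: abs_mult add_nonneg_nonneg intro!: mult_mono abs_spow_le p K)
  qed measurable
  note swap = edge_measure_swap[OF rw ne fin rev]
  have hs: "integrable ?J (\<lambda>(x, y). ?h (y, x))" and hse: "(\<integral>z. ?h z \<partial>?J) = (\<integral>(x, y). ?h (y, x) \<partial>?J)"
    using h swap integrable_distr_eq[of "\<lambda>(x, y). (y, x)" ?J "\<nu> \<Otimes>\<^sub>M \<nu>" ?h]
      integral_distr[of "\<lambda>(x, y). (y, x)" ?J "\<nu> \<Otimes>\<^sub>M \<nu>" ?h]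
    by (simp_all add: case_prod_unfold)
  have "2 * (\<integral>z. ?h z \<partial>?J) = (\<integral>z. ?h z + (case z of (x, y) \<Rightarrow> ?h (y, x)) \<partial>?J)"
    using h hs hse by (simp add: Bochner_Integration.integral_add)
  also have "\<dots> \<le> (\<integral>z. 0 \<partial>?J)"
  proof (rule integral_mono)
    show "integrable ?J (\<lambda>z. ?h z + (case z of (x, y) \<Rightarrow> ?h (y, x)))"
      using h hs by simp
    fix z :: "'a \<times> 'a"
    obtain x y where z: "z = (x, y)" by (cases z)
    have "spow p (u x - u y) = - spow p (u y - u x)" by (metis minus_diff_eq spow_minus)
    then show "?h z + (case z of (x, y) \<Rightarrow> ?h (y, x)) \<le> 0"
      using spow_mult_mono_le[OF T, of p "u y" "u x"] by (simp add: z algebra_simps)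
  qed simp
  finally have le: "(\<integral>z. ?h z \<partial>?J) \<le> 0" by simp
  have h': "?h \<in> borel_measurable (\<nu> \<Otimes>\<^sub>M \<nu>)" by measurable
  note E = integral_edge_measure[OF rw h' h]
  have "(\<integral>x. w x * T (u x) \<partial>\<nu>) = (\<integral>x. (\<integral>y. ?h (x, y) \<partial>m x) \<partial>\<nu>)"
  proof (rule integral_cong_AE)
    have "AE x in \<nu>. w x = (\<integral>y. spow p (u y - u x) \<partial>(m x))" using D by (simp add: Deltap_def)
    then show "AE x in \<nu>. w x * T (u x) = (\<integral>y. ?h (x, y) \<partial>m x)" by eventually_elim simp
  qed (use E(1) in auto)
  then show ?thesis using E(2) le by simp
qed

text \<open>Clip the values of \<open>T\<close> at level \<open>n\<close>: the result is bounded and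
  still nondecreasing. At each point the clipped value eventually equals \<open>T (u x)\<close>, and
  the products are dominated by the absolute value of \<open>w x * T (u x)\<close>, so the sign
  survives the limit.\<close>

lemma Deltap_dissipation:
  assumes p: "p > 1" and rw: "rw_space M m \<nu>" and rev: "reversible_rw M m \<nu>"
    and fin: "emeasure \<nu> (space \<nu>) < \<infinity>" and D: "Deltap p m \<nu> u w"
    and T: "mono T" and Tu: "L2 \<nu> (\<lambda>x. T (u x))"
  shows "(\<integral>x. w x * T (u x) \<partial>\<nu>) \<le> 0"
proof -
  let ?T = "\<lambda>n a. max (- real n) (min (real n) (T a))"
  have w: "L2 \<nu> w" using D by (simp add: Deltap_def)
  note [measurable] = L2_measurable[OF w] L2_measurable[OF Tu]
  have "(\<lambda>n. \<integral>x. w x * ?T n (u x) \<partial>\<nu>) \<longlonglongrightarrow> (\<integral>x. w x * T (u x) \<partial>\<nu>)"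
  proof (rule integral_dominated_convergence)
    show "integrable \<nu> (\<lambda>x. \<bar>w x * T (u x)\<bar>)"
      using L2_mult_integrable[OF w Tu] by (rule integrable_abs)
    show "AE x in \<nu>. (\<lambda>n. w x * ?T n (u x)) \<longlonglongrightarrow> w x * T (u x)"
    proof (rule AE_I2)
      fix x
      obtain N where N: "\<bar>T (u x)\<bar> \<le> real N" using real_arch_simple by blast
      have "\<forall>\<^sub>F n in sequentially. w x * ?T n (u x) = w x * T (u x)"
        using eventually_ge_at_top[of N]
      proof eventually_elim
        case (elim n)
        then have "\<bar>T (u x)\<bar> \<le> real n" using N by linarith
        then have "?T n (u x) = T (u x)" by linarith
        then show ?case by simp
      qed
      then show "(\<lambda>n. w x * ?T n (u x)) \<longlonglongrightarrow> w x * T (u x)" by (rule tendsto_eventually)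
    qed
    show "AE x in \<nu>. norm (w x * ?T n (u x)) \<le> \<bar>w x * T (u x)\<bar>" for n
      by (intro AE_I2) (auto simp: abs_mult intro!: mult_left_mono)
  qed measurable
  moreover have "(\<integral>x. w x * ?T n (u x) \<partial>\<nu>) \<le> 0" for n
    by (rule Deltap_dissipation_bounded[OF p rw rev fin D, of _ "real n"])
      (use T in \<open>auto intro!: monoI max.mono min.mono dest: monoD\<close>)
  ultimately show ?thesis by (intro LIMSEQ_le_const2) auto
qed

section \<open>Dissipativity of the 1-Laplacian and of the full operator\<close>

lemma F1_contraction:
  assumes "\<And>a b. \<bar>S a - S b\<bar> \<le> \<bar>a - b\<bar>"
  shows "F1 m \<nu> (\<lambda>x. S (u x)) \<le> F1 m \<nu> u"
  unfolding F1_def by (intro mult_left_mono nn_integral_mono ennreal_leI assms) simp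

text \<open>Test the subgradient inequality at \<open>u - T(u)\<close>.\<close>
lemma Delta1_dissipation:
  assumes D: "Delta1 m \<nu> u (\<lambda>x. - v x)" and T: "mono T" and L: "\<And>a b. \<bar>T a - T b\<bar> \<le> \<bar>a - b\<bar>"
    and Tu: "L2 \<nu> (\<lambda>x. T (u x))"
  shows "F1 m \<nu> (\<lambda>x. u x - T (u x)) \<le> F1 m \<nu> u"
    and "enn2real (F1 m \<nu> u) - enn2real (F1 m \<nu> (\<lambda>x. u x - T (u x))) \<le> (\<integral>x. v x * T (u x) \<partial>\<nu>)"
proof -
  \<comment> \<open>An increment of \<open>T\<close> has the same sign as that of its argument and
    is no larger, so subtracting it leaves between nothing and the whole increment.\<close>
  have S: "\<bar>(a - T a) - (b - T b)\<bar> \<le> \<bar>a - b\<bar>" for a b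
    using L[of a b] monoD[OF T, of a b] monoD[OF T, of b a] by linarith
  show le: "F1 m \<nu> (\<lambda>x. u x - T (u x)) \<le> F1 m \<nu> u"
    by (rule F1_contraction[OF S])
  have fin: "F1 m \<nu> u < \<infinity>" and u: "L2 \<nu> u"
    and sub: "\<And>z. L2 \<nu> z \<Longrightarrow> enn2ereal (F1 m \<nu> u) + ereal (\<integral>x. v x * (z x - u x) \<partial>\<nu>) \<le> enn2ereal (F1 m \<nu> z)"
    using D by (auto simp: Delta1_def subdiffL2_def)
  obtain a where a: "F1 m \<nu> u = ennreal a" "0 \<le> a" using fin by (cases "F1 m \<nu> u") auto
  obtain b where b: "F1 m \<nu> (\<lambda>x. u x - T (u x)) = ennreal b" "0 \<le> b"
    using fin le by (cases "F1 m \<nu> (\<lambda>x. u x - T (u x))") (auto simp: top_unique)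
  have "a + (\<integral>x. v x * (- T (u x)) \<partial>\<nu>) \<le> b"
    using sub[OF L2_diff[OF u Tu]] by (simp add: a b enn2ereal_ennreal)
  then show "enn2real (F1 m \<nu> u) - enn2real (F1 m \<nu> (\<lambda>x. u x - T (u x))) \<le> (\<integral>x. v x * T (u x) \<partial>\<nu>)"
    by (simp add: a b)
qed

text \<open>Here \<open>g\<close> plays the role of the time derivative. Multiply
  \<open>g = \<mu> w - v1\<close> by \<open>T (u x)\<close> and integrate: the density turns the
  first term into a p-Laplacian pairing over \<open>\<nu>2\<close>, and the second is controlled by
  \<open>Delta1_dissipation\<close>. The bound \<open>K\<close> transfers square integrability and
  finite mass from \<open>\<nu>1\<close> to \<open>\<nu>2\<close>. The last two conclusions ensure
  that \<open>enn2real\<close> loses nothing.\<close>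

lemma opA_dissipation:
  assumes p: "p > 1" and rw: "rw_space M m2 \<nu>2" and rev: "reversible_rw M m2 \<nu>2"
    and \<mu>[measurable]: "\<mu> \<in> borel_measurable \<nu>1" and \<nu>2: "\<nu>2 = density \<nu>1 (\<lambda>x. ennreal (\<mu> x))"
    and K: "AE x in \<nu>1. \<mu> x \<le> K" and pos: "AE x in \<nu>1. \<mu> x \<ge> 0"
    and fin: "emeasure \<nu>1 (space \<nu>1) < \<infinity>"
    and A: "opA p m1 \<nu>1 m2 \<nu>2 \<mu> u (\<lambda>x. - g x)"
    and T: "mono T" and L: "\<And>a b. \<bar>T a - T b\<bar> \<le> \<bar>a - b\<bar>" and Tu: "L2 \<nu>1 (\<lambda>x. T (u x))"
  shows "(\<integral>x. T (u x) * g x \<partial>\<nu>1)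
    \<le> enn2real (F1 m1 \<nu>1 (\<lambda>x. u x - T (u x))) - enn2real (F1 m1 \<nu>1 u)"
    and "F1 m1 \<nu>1 (\<lambda>x. u x - T (u x)) \<le> F1 m1 \<nu>1 u" and "F1 m1 \<nu>1 u < \<infinity>"
proof -
  obtain v1 w where D1: "Delta1 m1 \<nu>1 u (\<lambda>x. - v1 x)" and Dp: "Deltap p m2 \<nu>2 u w"
    and g: "AE x in \<nu>1. - g x = v1 x - \<mu> x * w x" and gL: "L2 \<nu>1 (\<lambda>x. - g x)"
    using A by (auto simp: opA_def)
  note D = Delta1_dissipation[OF D1 T L Tu]
  show "F1 m1 \<nu>1 (\<lambda>x. u x - T (u x)) \<le> F1 m1 \<nu>1 u" by (rule D(1))
  show "F1 m1 \<nu>1 u < \<infinity>" using D1 by (simp add: Delta1_def subdiffL2_def)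
  have v1: "L2 \<nu>1 v1" using D1 by (simp add: Delta1_def subdiffL2_def)
  have w: "L2 \<nu>2 w" using Dp by (simp add: Deltap_def)
  have [measurable]: "w \<in> borel_measurable \<nu>1" "v1 \<in> borel_measurable \<nu>1" "g \<in> borel_measurable \<nu>1"
    "(\<lambda>x. T (u x)) \<in> borel_measurable \<nu>1"
    using w v1 L2_measurable[OF L2_uminus[OF gL]] Tu by (auto simp: L2_def \<nu>2)
  have Tu2: "L2 \<nu>2 (\<lambda>x. T (u x))"
    unfolding L2_def
  proof
    have "integrable \<nu>1 (\<lambda>x. \<mu> x *\<^sub>R (T (u x))\<^sup>2)"
    proof (rule Bochner_Integration.integrable_bound)
      show "integrable \<nu>1 (\<lambda>x. K * (T (u x))\<^sup>2)" using Tu by (simp add: L2_def)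
      show "AE x in \<nu>1. norm (\<mu> x *\<^sub>R (T (u x))\<^sup>2) \<le> norm (K * (T (u x))\<^sup>2)"
        using K pos by eventually_elim (auto simp: abs_mult intro!: mult_right_mono)
    qed measurable
    then show "integrable \<nu>2 (\<lambda>x. (T (u x))\<^sup>2)"
      unfolding \<nu>2 using pos by (subst integrable_density) auto
  qed (simp add: \<nu>2)
  have "emeasure \<nu>2 (space \<nu>2) = (\<integral>\<^sup>+x. ennreal (\<mu> x) \<partial>\<nu>1)"
    unfolding \<nu>2 by (subst emeasure_density) (auto intro!: nn_integral_cong)
  also have "\<dots> \<le> (\<integral>\<^sup>+x. ennreal K \<partial>\<nu>1)"
    by (rule nn_integral_mono_AE) (use K in eventually_elim, auto intro: ennreal_leI)
  also have "\<dots> < \<infinity>" using fin by (simp add: ennreal_mult_less_top)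
  finally have fin2: "emeasure \<nu>2 (space \<nu>2) < \<infinity>" .
  have i2: "integrable \<nu>1 (\<lambda>x. \<mu> x * (w x * T (u x)))"
    using L2_mult_integrable[OF w Tu2] pos unfolding \<nu>2 by (subst (asm) integrable_density) auto
  have i1: "integrable \<nu>1 (\<lambda>x. v1 x * T (u x))" by (rule L2_mult_integrable[OF v1 Tu])
  have "(\<integral>x. T (u x) * g x \<partial>\<nu>1) = (\<integral>x. \<mu> x * (w x * T (u x)) - v1 x * T (u x) \<partial>\<nu>1)"
  proof (rule integral_cong_AE)
    show "AE x in \<nu>1. T (u x) * g x = \<mu> x * (w x * T (u x)) - v1 x * T (u x)"
      using g
    proof eventually_elim
      case (elim x)
      then have eq: "g x = \<mu> x * w x - v1 x" by simp
      show ?case unfolding eq by (simp add: algebra_simps)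
    qed
  qed measurable
  also have "\<dots> = (\<integral>x. \<mu> x * (w x * T (u x)) \<partial>\<nu>1) - (\<integral>x. v1 x * T (u x) \<partial>\<nu>1)"
    using i1 i2 by simp
  also have "(\<integral>x. \<mu> x * (w x * T (u x)) \<partial>\<nu>1) = (\<integral>x. w x * T (u x) \<partial>\<nu>2)"
    unfolding \<nu>2 using pos by (subst integral_density) auto
  finally show "(\<integral>x. T (u x) * g x \<partial>\<nu>1)
    \<le> enn2real (F1 m1 \<nu>1 (\<lambda>x. u x - T (u x))) - enn2real (F1 m1 \<nu>1 u)"
    using Deltap_dissipation[OF p rw rev fin2 Dp T Tu2] D(2) by linarith
qed

section \<open>Integrated chain inequality along the evolution\<close>

text \<open>Bound \<open>|f q| * a\<close> by half of \<open>(f q)^2 + a^2\<close> at each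
  \<open>q\<close> and integrate, enlarging \<open>[r, t]\<close> to \<open>[s, t]\<close> so that
  the bound does not depend on \<open>r\<close>.\<close>

lemma increment_product_bound:
  fixes f :: "real \<Rightarrow> real"
  assumes [measurable]: "f \<in> borel_measurable borel"
    and i: "integrable lborel (\<lambda>q. indicator {s..t} q * (f q)\<^sup>2)"
    and r: "s \<le> r" "r \<le> t" and a: "0 \<le> a"
  shows "\<bar>LINT q:{r..t}|lborel. f q\<bar> * a
    \<le> ((\<integral>q. indicator {s..t} q * (f q)\<^sup>2 \<partial>lborel) + (t - s) * a\<^sup>2) / 2"
proof -
  have j: "integrable lborel (\<lambda>q. indicator {s..t} q * a\<^sup>2)"
    using r by (auto intro!: integrable_mult_left integrable_real_indicator)
  have "\<bar>LINT q:{r..t}|lborel. f q\<bar> * a \<le> (\<integral>q. \<bar>indicator {r..t} q * f q\<bar> \<partial>lborel) * a"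
    unfolding set_lebesgue_integral_def using a by (intro mult_right_mono integral_abs_bound[THEN order_trans]) auto
  also have "\<dots> = (\<integral>q. \<bar>indicator {r..t} q * f q\<bar> * a \<partial>lborel)" by simp
  also have "\<dots> \<le> (\<integral>q. (indicator {s..t} q * (f q)\<^sup>2 + indicator {s..t} q * a\<^sup>2) / 2 \<partial>lborel)"
  proof (rule integral_mono')
    show "integrable lborel (\<lambda>q. (indicator {s..t} q * (f q)\<^sup>2 + indicator {s..t} q * a\<^sup>2) / 2)"
      using i j by simp
    fix q
    have "2 * \<bar>f q\<bar> * a \<le> (f q)\<^sup>2 + a\<^sup>2"
      using sum_squares_bound[of "\<bar>f q\<bar>" a] by simp
    then show "\<bar>indicator {r..t} q * f q\<bar> * a \<le> (indicator {s..t} q * (f q)\<^sup>2 + indicator {s..t} q * a\<^sup>2) / 2"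
      using r by (auto simp: indicator_def)
    show "0 \<le> (indicator {s..t} q * (f q)\<^sup>2 + indicator {s..t} q * a\<^sup>2) / 2" by simp
  qed
  also have "\<dots> = ((\<integral>q. indicator {s..t} q * (f q)\<^sup>2 \<partial>lborel) + (t - s) * a\<^sup>2) / 2"
    using i j r by (simp add: Bochner_Integration.integral_add)
  finally show ?thesis .
qed

text \<open>Comparing \<open>T(u(t))\<close> with \<open>T(u(r))\<close> costs at most the time step times the
  energy of \<open>u\<^sub>t\<close> over the step, an error of second order that vanishes when
  summed over fine partitions; this replaces the chain rule.\<close>
lemma evolution_step:
  fixes u ut :: "real \<Rightarrow> 'a \<Rightarrow> real" and T j :: "real \<Rightarrow> real"
  assumes fin: "finite_measure \<nu>"
    and ut[measurable]: "(\<lambda>(r, x). ut r x) \<in> borel_measurable (lborel \<Otimes>\<^sub>M \<nu>)"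
    and en: "(\<integral>\<^sup>+ r. indicator {s..t} r * (\<integral>\<^sup>+ x. ennreal ((ut r x)\<^sup>2) \<partial>\<nu>) \<partial>lborel) < \<infinity>"
    and st: "s \<le> t"
    and inc: "\<And>r. s \<le> r \<Longrightarrow> r \<le> t \<Longrightarrow> AE x in \<nu>. u t x - u r x = (LINT q:{r..t}|lborel. ut q x)"
    and u: "\<And>r. s \<le> r \<Longrightarrow> r \<le> t \<Longrightarrow> L2 \<nu> (u r)"
    and lip: "\<And>a b. \<bar>T a - T b\<bar> \<le> \<bar>a - b\<bar>"
    and Tu: "\<And>r. s \<le> r \<Longrightarrow> r \<le> t \<Longrightarrow> L2 \<nu> (\<lambda>x. T (u r x))"
    and ju: "\<And>r. s \<le> r \<Longrightarrow> r \<le> t \<Longrightarrow> integrable \<nu> (\<lambda>x. j (u r x))"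
    and jT: "\<And>a b. j b - j a \<le> T b * (b - a)"
    and diss: "AE r in lborel. s \<le> r \<longrightarrow> r \<le> t \<longrightarrow> L2 \<nu> (ut r) \<and> (\<integral>x. T (u r x) * ut r x \<partial>\<nu>) \<le> - C"
  shows "integrable lborel (\<lambda>r. indicator {s..t} r * (\<integral>x. (ut r x)\<^sup>2 \<partial>\<nu>))"
    and "(\<integral>x. j (u t x) \<partial>\<nu>) - (\<integral>x. j (u s x) \<partial>\<nu>)
      \<le> (t - s) * (\<integral>r. indicator {s..t} r * (\<integral>x. (ut r x)\<^sup>2 \<partial>\<nu>) \<partial>lborel) - C * (t - s)"
proof -
  interpret N: finite_measure \<nu> by fact
  interpret pair_sigma_finite lborel \<nu> by standard
  let ?I = "indicator {s..t} :: real \<Rightarrow> real"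
  let ?phi = "\<lambda>r. \<integral>x. (ut r x)\<^sup>2 \<partial>\<nu>" and ?Phi = "\<lambda>x. \<integral>r. ?I r * (ut r x)\<^sup>2 \<partial>lborel"
  define E where "E = (\<integral>r. ?I r * ?phi r \<partial>lborel)"
  note Tt[measurable] = L2_measurable[OF Tu[OF st order_refl]]
  \<comment> \<open>\<open>G\<close> lets the energy \<open>E\<close> be computed in either order.
    \<open>H\<close>, dominated by the sum of \<open>T2\<close> and \<open>G\<close>, justifies
    exchanging the integrals in the pairing with \<open>ut\<close>.\<close>
  have G: "integrable (lborel \<Otimes>\<^sub>M \<nu>) (\<lambda>(r, x). ?I r * (ut r x)\<^sup>2)"
  proof (rule integrableI_nonneg)
    have "(\<integral>\<^sup>+z. ennreal (case z of (r, x) \<Rightarrow> ?I r * (ut r x)\<^sup>2) \<partial>(lborel \<Otimes>\<^sub>M \<nu>))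
      = (\<integral>\<^sup>+r. (\<integral>\<^sup>+x. ennreal (?I r * (ut r x)\<^sup>2) \<partial>\<nu>) \<partial>lborel)"
      using N.nn_integral_fst[of "\<lambda>z. ennreal (case z of (r, x) \<Rightarrow> ?I r * (ut r x)\<^sup>2)" lborel] by simp
    also have "\<dots> = (\<integral>\<^sup>+ r. indicator {s..t} r * (\<integral>\<^sup>+ x. ennreal ((ut r x)\<^sup>2) \<partial>\<nu>) \<partial>lborel)"
      by (intro nn_integral_cong) (simp add: indicator_def)
    finally show "(\<integral>\<^sup>+z. ennreal (case z of (r, x) \<Rightarrow> ?I r * (ut r x)\<^sup>2) \<partial>(lborel \<Otimes>\<^sub>M \<nu>)) < \<infinity>"
      using en by simp
  qed auto
  have T2: "integrable (lborel \<Otimes>\<^sub>M \<nu>) (\<lambda>(r, x). ?I r * (T (u t x))\<^sup>2)"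
  proof (rule integrableI_nonneg)
    have "(\<integral>\<^sup>+z. ennreal (case z of (r, x) \<Rightarrow> ?I r * (T (u t x))\<^sup>2) \<partial>(lborel \<Otimes>\<^sub>M \<nu>))
      = (\<integral>\<^sup>+r. (\<integral>\<^sup>+x. ennreal (?I r * (T (u t x))\<^sup>2) \<partial>\<nu>) \<partial>lborel)"
      using N.nn_integral_fst[of "\<lambda>z. ennreal (case z of (r, x) \<Rightarrow> ?I r * (T (u t x))\<^sup>2)" lborel] by simp
    also have "\<dots> = (\<integral>\<^sup>+ r. (\<integral>\<^sup>+ x. ennreal ((T (u t x))\<^sup>2) \<partial>\<nu>) * indicator {s..t} r \<partial>lborel)"
      by (intro nn_integral_cong) (simp add: indicator_def)
    also have "\<dots> = (\<integral>\<^sup>+ x. ennreal ((T (u t x))\<^sup>2) \<partial>\<nu>) * ennreal (t - s)"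
      using st by (subst nn_integral_cmult_indicator) auto
    also have "\<dots> < \<infinity>"
      using Tu[OF st order_refl] by (auto simp: L2_def nn_integral_eq_integral ennreal_mult_less_top)
    finally show "(\<integral>\<^sup>+z. ennreal (case z of (r, x) \<Rightarrow> ?I r * (T (u t x))\<^sup>2) \<partial>(lborel \<Otimes>\<^sub>M \<nu>)) < \<infinity>" .
  qed auto
  have H: "integrable (lborel \<Otimes>\<^sub>M \<nu>) (\<lambda>(r, x). ?I r * (T (u t x) * ut r x))"
  proof (rule Bochner_Integration.integrable_bound[OF Bochner_Integration.integrable_add[OF T2 G]])
    have b: "\<bar>a * b\<bar> \<le> a\<^sup>2 + b\<^sup>2" for a b :: real
      using sum_squares_bound[of "\<bar>a\<bar>" "\<bar>b\<bar>"] abs_ge_zero[of "a * b"]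
      by (simp only: abs_mult power2_abs mult.assoc)
    show "AE z in lborel \<Otimes>\<^sub>M \<nu>. norm (case z of (r, x) \<Rightarrow> ?I r * (T (u t x) * ut r x))
        \<le> norm ((case z of (r, x) \<Rightarrow> ?I r * (T (u t x))\<^sup>2) + (case z of (r, x) \<Rightarrow> ?I r * (ut r x)\<^sup>2))"
      by (intro AE_I2) (auto simp: indicator_def b)
  qed measurable
  show iphi: "integrable lborel (\<lambda>r. ?I r * ?phi r)"
    using integrable_fst[OF G] by simp
  have iPhi: "integrable \<nu> ?Phi" using integrable_snd[OF G] by simp
  have EPhi: "(\<integral>x. ?Phi x \<partial>\<nu>) = E"
    using Fubini_integral[OF G] by (simp add: E_def)
  have AEPhi: "AE x in \<nu>. integrable lborel (\<lambda>q. ?I q * (ut q x)\<^sup>2)"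
    using AE_integrable_snd[OF G] by simp
  have mut: "(\<lambda>q. ut q x) \<in> borel_measurable borel" if "x \<in> space \<nu>" for x
    using measurable_Pair1[OF ut that] by simp
  have dI: "integrable \<nu> (\<lambda>x. T (u t x) * (u t x - u s x))"
    by (rule L2_mult_integrable[OF Tu L2_diff[OF u u]]) (use st in auto)
  have "(\<integral>x. j (u t x) \<partial>\<nu>) - (\<integral>x. j (u s x) \<partial>\<nu>) = (\<integral>x. j (u t x) - j (u s x) \<partial>\<nu>)"
    using ju st by simp
  \<comment> \<open>The subgradient inequality freezes \<open>T\<close> at the final time
    \<open>t\<close>, whereas \<open>diss\<close> speaks about \<open>T (u r x)\<close>; the
    discrepancy is the error to be controlled.\<close>
  also have "\<dots> \<le> (\<integral>x. T (u t x) * (u t x - u s x) \<partial>\<nu>)"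
    by (rule integral_mono[OF _ dI jT]) (use ju st in simp)
  also have "\<dots> = (\<integral>x. (\<integral>r. ?I r * (T (u t x) * ut r x) \<partial>lborel) \<partial>\<nu>)"
  proof (rule integral_cong_AE)
    show "(\<lambda>x. \<integral>r. ?I r * (T (u t x) * ut r x) \<partial>lborel) \<in> borel_measurable \<nu>"
      using integrable_snd[OF H] by simp
    show "AE x in \<nu>. T (u t x) * (u t x - u s x) = (\<integral>r. ?I r * (T (u t x) * ut r x) \<partial>lborel)"
      using inc[OF order_refl st]
    proof eventually_elim
      case (elim x)
      have "(\<integral>r. ?I r * (T (u t x) * ut r x) \<partial>lborel) = (\<integral>r. T (u t x) * (?I r * ut r x) \<partial>lborel)"
        by (simp add: mult.left_commute)
      also have "\<dots> = T (u t x) * (u t x - u s x)"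
        by (simp add: elim set_lebesgue_integral_def)
      finally show ?case by simp
    qed
  qed (use dI in simp)
  also have "\<dots> = (\<integral>r. (\<integral>x. ?I r * (T (u t x) * ut r x) \<partial>\<nu>) \<partial>lborel)"
    by (rule Fubini_integral[OF H])
  \<comment> \<open>\<open>- C\<close> comes from \<open>diss\<close> at time \<open>r\<close>. The
    freezing error is bounded by the integral over \<open>x\<close> of half of
    \<open>?Phi x + (t - s) * (ut r x)^2\<close>, which gives the other two terms; integrated over
    \<open>[s, t]\<close>, each contributes \<open>(t - s) * E / 2\<close>.\<close>
  also have "\<dots> \<le> (\<integral>r. (E / 2 - C) * ?I r + (t - s) / 2 * (?I r * ?phi r) \<partial>lborel)"
  proof (rule integral_mono_AE)
    show "integrable lborel (\<lambda>r. \<integral>x. ?I r * (T (u t x) * ut r x) \<partial>\<nu>)"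
      using integrable_fst[OF H] by simp
    show "integrable lborel (\<lambda>r. (E / 2 - C) * ?I r + (t - s) / 2 * (?I r * ?phi r))"
      using iphi st by (intro Bochner_Integration.integrable_add integrable_mult_right integrable_real_indicator) auto
    show "AE r in lborel. (\<integral>x. ?I r * (T (u t x) * ut r x) \<partial>\<nu>)
        \<le> (E / 2 - C) * ?I r + (t - s) / 2 * (?I r * ?phi r)"
      using diss
    proof eventually_elim
      case (elim r)
      show ?case
      proof (cases "s \<le> r \<and> r \<le> t")
        case False
        then have "?I r = 0" by (auto simp: indicator_def)
        then show ?thesis by simp
      next
        case True
        then have r: "s \<le> r" "r \<le> t" and I: "?I r = 1" by auto
        have utr: "L2 \<nu> (ut r)" and d: "(\<integral>x. T (u r x) * ut r x \<partial>\<nu>) \<le> - C" using elim r by auto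
        have i1: "integrable \<nu> (\<lambda>x. T (u r x) * ut r x)" by (rule L2_mult_integrable[OF Tu[OF r] utr])
        have i2: "integrable \<nu> (\<lambda>x. (T (u t x) - T (u r x)) * ut r x)"
          by (rule L2_mult_integrable[OF L2_diff[OF Tu[OF st order_refl] Tu[OF r]] utr])
        have i3: "integrable \<nu> (\<lambda>x. (ut r x)\<^sup>2)" using utr by (simp add: L2_def)
        have "(\<integral>x. T (u t x) * ut r x \<partial>\<nu>)
            = (\<integral>x. T (u r x) * ut r x + (T (u t x) - T (u r x)) * ut r x \<partial>\<nu>)"
          by (simp add: algebra_simps)
        also have "\<dots> = (\<integral>x. T (u r x) * ut r x \<partial>\<nu>) + (\<integral>x. (T (u t x) - T (u r x)) * ut r x \<partial>\<nu>)"
          using i1 i2 by (rule Bochner_Integration.integral_add)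
        also have "(\<integral>x. (T (u t x) - T (u r x)) * ut r x \<partial>\<nu>) \<le> (\<integral>x. (?Phi x + (t - s) * (ut r x)\<^sup>2) / 2 \<partial>\<nu>)"
        proof (rule integral_mono_AE[OF i2])
          show "integrable \<nu> (\<lambda>x. (?Phi x + (t - s) * (ut r x)\<^sup>2) / 2)" using iPhi i3 by simp
          show "AE x in \<nu>. (T (u t x) - T (u r x)) * ut r x \<le> (?Phi x + (t - s) * (ut r x)\<^sup>2) / 2"
            using inc[OF r] AEPhi AE_space
          proof eventually_elim
            case (elim x)
            have "(T (u t x) - T (u r x)) * ut r x \<le> \<bar>T (u t x) - T (u r x)\<bar> * \<bar>ut r x\<bar>"
              by (metis abs_ge_self abs_mult)
            also have "\<dots> \<le> \<bar>u t x - u r x\<bar> * \<bar>ut r x\<bar>" by (intro mult_right_mono lip) simp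
            also have "\<dots> \<le> (?Phi x + (t - s) * \<bar>ut r x\<bar>\<^sup>2) / 2"
              unfolding elim(1)
              by (rule increment_product_bound[OF mut[OF elim(3)] elim(2) r]) simp
            finally show ?case by simp
          qed
        qed
        also have "\<dots> = (E + (t - s) * ?phi r) / 2"
          using iPhi i3 by (simp add: EPhi)
        finally have "(\<integral>x. T (u t x) * ut r x \<partial>\<nu>) \<le> - C + (E + (t - s) * ?phi r) / 2"
          using d by simp
        then show ?thesis by (simp add: I field_simps)
      qed
    qed
  qed
  also have "\<dots> = (E / 2 - C) * (t - s) + (t - s) / 2 * E"
    using iphi st by (subst Bochner_Integration.integral_add) (auto simp: E_def)
  also have "\<dots> = (t - s) * E - C * (t - s)" by (simp add: field_simps)
  finally show "(\<integral>x. j (u t x) \<partial>\<nu>) - (\<integral>x. j (u s x) \<partial>\<nu>)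
      \<le> (t - s) * (\<integral>r. ?I r * ?phi r \<partial>lborel) - C * (t - s)"
    by (simp add: E_def)
qed

text \<open>Cut \<open>[a, b]\<close> into \<open>n + 1\<close> equal pieces. On summing, the bounds
  telescope to the mesh times \<open>e b - e a\<close>, and the mesh tends to 0.\<close>

lemma second_order_increment_le:
  fixes f e :: "real \<Rightarrow> real"
  assumes ab: "a \<le> b"
    and inc: "\<And>s t. a \<le> s \<Longrightarrow> s \<le> t \<Longrightarrow> t \<le> b \<Longrightarrow> f t - f s \<le> (t - s) * (e t - e s)"
  shows "f b \<le> f a"
proof -
  have *: "f b - f a \<le> (b - a) * (e b - e a) * (1 / real (Suc n))" for n
  proof -
    define h where "h = (b - a) / real (Suc n)"
    define x where "x i = a + real i * h" for i
    have h: "0 \<le> h" using ab by (simp add: h_def)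
    have x0: "x 0 = a" and xn: "x (Suc n) = b" by (simp_all add: x_def h_def)
    have "f (x (Suc i)) - f (x i) \<le> h * (e (x (Suc i)) - e (x i))" if "i < Suc n" for i
    proof -
      have d: "x (Suc i) - x i = h" by (simp add: x_def algebra_simps)
      have "x (Suc i) \<le> x (Suc n)"
        unfolding x_def using that h by (intro add_left_mono mult_right_mono) auto
      then show ?thesis
        using inc[of "x i" "x (Suc i)"] h d xn by (simp add: x_def)
    qed
    then have "(\<Sum>i<Suc n. f (x (Suc i)) - f (x i)) \<le> (\<Sum>i<Suc n. h * (e (x (Suc i)) - e (x i)))"
      by (intro sum_mono) auto
    then have "f (x (Suc n)) - f (x 0) \<le> h * (e (x (Suc n)) - e (x 0))"
      by (simp only: sum_lessThan_telescope[of "\<lambda>i. f (x i)"]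
          sum_lessThan_telescope[of "\<lambda>i. e (x i)"] sum_distrib_left[symmetric])
    then show ?thesis by (simp add: x0 xn) (simp add: h_def)
  qed
  have "(\<lambda>n. (b - a) * (e b - e a) * (1 / real (Suc n))) \<longlonglongrightarrow> (b - a) * (e b - e a) * 0"
    using LIMSEQ_inverse_real_of_nat by (intro tendsto_mult tendsto_const) (simp add: inverse_eq_divide)
  then have "f b - f a \<le> (b - a) * (e b - e a) * 0" by (rule LIMSEQ_le_const) (use * in auto)
  then show ?thesis by simp
qed

text \<open>Take for \<open>e\<close> the energy of \<open>ut\<close> accumulated since
  \<open>a\<close>. Adding \<open>C * (t - a)\<close> to the integral of \<open>j\<close> absorbs
  the dissipation rate, and \<open>evolution_step\<close> then gives exactly the increments that
  \<open>second_order_increment_le\<close> asks for.\<close>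

lemma evolution_estimate:
  fixes u ut :: "real \<Rightarrow> 'a \<Rightarrow> real" and T j :: "real \<Rightarrow> real"
  assumes fin: "finite_measure \<nu>"
    and ut: "(\<lambda>(r, x). ut r x) \<in> borel_measurable (lborel \<Otimes>\<^sub>M \<nu>)"
    and en: "\<And>s t. a \<le> s \<Longrightarrow> s \<le> t \<Longrightarrow>
      (\<integral>\<^sup>+ r. indicator {s..t} r * (\<integral>\<^sup>+ x. ennreal ((ut r x)\<^sup>2) \<partial>\<nu>) \<partial>lborel) < \<infinity>"
    and ab: "a \<le> b"
    and inc: "\<And>s t. a \<le> s \<Longrightarrow> s \<le> t \<Longrightarrow> AE x in \<nu>. u t x - u s x = (LINT q:{s..t}|lborel. ut q x)"
    and u: "\<And>r. a \<le> r \<Longrightarrow> L2 \<nu> (u r)"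
    and lip: "\<And>a b. \<bar>T a - T b\<bar> \<le> \<bar>a - b\<bar>"
    and Tu: "\<And>r. a \<le> r \<Longrightarrow> L2 \<nu> (\<lambda>x. T (u r x))"
    and ju: "\<And>r. a \<le> r \<Longrightarrow> integrable \<nu> (\<lambda>x. j (u r x))"
    and jT: "\<And>a b. j b - j a \<le> T b * (b - a)"
    and diss: "AE r in lborel. a \<le> r \<longrightarrow> r \<le> b \<longrightarrow> L2 \<nu> (ut r) \<and> (\<integral>x. T (u r x) * ut r x \<partial>\<nu>) \<le> - C"
  shows "(\<integral>x. j (u b x) \<partial>\<nu>) + C * (b - a) \<le> (\<integral>x. j (u a x) \<partial>\<nu>)"
proof -
  let ?phi = "\<lambda>r. \<integral>x. (ut r x)\<^sup>2 \<partial>\<nu>"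
  define e where "e t = (\<integral>r. indicator {a..t} r * ?phi r \<partial>lborel)" for t
  define f where "f t = (\<integral>x. j (u t x) \<partial>\<nu>) + C * (t - a)" for t
  have step: "integrable lborel (\<lambda>r. indicator {s..t} r * ?phi r)"
    "(\<integral>x. j (u t x) \<partial>\<nu>) - (\<integral>x. j (u s x) \<partial>\<nu>)
      \<le> (t - s) * (\<integral>r. indicator {s..t} r * ?phi r \<partial>lborel) - C * (t - s)"
    if "a \<le> s" "s \<le> t" "t \<le> b" for s t
  proof -
    have d: "AE r in lborel. s \<le> r \<longrightarrow> r \<le> t \<longrightarrow> L2 \<nu> (ut r) \<and> (\<integral>x. T (u r x) * ut r x \<partial>\<nu>) \<le> - C"
      using diss by eventually_elim (use that in auto)
    note S = evolution_step[where u = u and T = T and j = j, OF fin ut en[OF that(1,2)] that(2) inc u lip Tu ju jT d]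
    show "integrable lborel (\<lambda>r. indicator {s..t} r * ?phi r)" by (rule S) (use that in auto)
    show "(\<integral>x. j (u t x) \<partial>\<nu>) - (\<integral>x. j (u s x) \<partial>\<nu>)
      \<le> (t - s) * (\<integral>r. indicator {s..t} r * ?phi r \<partial>lborel) - C * (t - s)"
      by (rule S) (use that in auto)
  qed
  have "f b \<le> f a"
  proof (rule second_order_increment_le[where e = e, OF ab])
    fix s t assume st: "a \<le> s" "s \<le> t" "t \<le> b"
    have i1: "integrable lborel (\<lambda>r. indicator {a..s} r * ?phi r)" by (rule step(1)) (use st in auto)
    have i2: "integrable lborel (\<lambda>r. indicator {s..t} r * ?phi r)" by (rule step(1)) (use st in auto)
    have i3: "integrable lborel (\<lambda>r. indicator {a..t} r * ?phi r)" by (rule step(1)) (use st in auto)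
    have "e t = (\<integral>r. indicator {a..s} r * ?phi r + indicator {s..t} r * ?phi r \<partial>lborel)"
      unfolding e_def
    proof (rule integral_cong_AE)
      \<comment> \<open>Both closed intervals contain \<open>s\<close>, so the indicators fail to
        add up at this single point.\<close>
      have "AE r in lborel. r \<noteq> s" by (rule AE_lborel_singleton)
      then show "AE r in lborel. indicator {a..t} r * ?phi r = indicator {a..s} r * ?phi r + indicator {s..t} r * ?phi r"
        by eventually_elim (use st in \<open>auto simp: indicator_def\<close>)
    qed (use i1 i2 i3 in auto)
    then have "e t - e s = (\<integral>r. indicator {s..t} r * ?phi r \<partial>lborel)"
      using i1 i2 by (simp add: e_def)
    then show "f t - f s \<le> (t - s) * (e t - e s)"
      using step(2)[OF st] by (simp add: f_def algebra_simps)
  qed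
  then show ?thesis by (simp add: f_def)
qed

section \<open>Cauchy-Schwarz and Huber functions\<close>

lemma L2norm_power2: "(L2norm \<nu> f)\<^sup>2 = (\<integral>x. (f x)\<^sup>2 \<partial>\<nu>)"
  by (simp add: L2norm_def)

text \<open>Integrating the square of \<open>?A * g x - ?I * f x\<close> gives
  \<open>?A * (?A * ?B - ?I^2)\<close>, hence the claim when \<open>?A\<close> is positive. If
  \<open>?A\<close> is 0, then \<open>f\<close> vanishes almost everywhere and so does
  \<open>?I\<close>.\<close>

lemma L2_Cauchy_Schwarz:
  assumes f: "L2 \<nu> f" and g: "L2 \<nu> g"
  shows "\<bar>\<integral>x. f x * g x \<partial>\<nu>\<bar> \<le> L2norm \<nu> f * L2norm \<nu> g"
proof -
  let ?A = "\<integral>x. (f x)\<^sup>2 \<partial>\<nu>" and ?B = "\<integral>x. (g x)\<^sup>2 \<partial>\<nu>" and ?I = "\<integral>x. f x * g x \<partial>\<nu>"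
  have if2: "integrable \<nu> (\<lambda>x. (f x)\<^sup>2)" and ig2: "integrable \<nu> (\<lambda>x. (g x)\<^sup>2)"
    using f g by (auto simp: L2_def)
  note ifg = L2_mult_integrable[OF f g]
  have "?I\<^sup>2 \<le> ?A * ?B"
  proof (cases "?A = 0")
    case True
    then have "AE x in \<nu>. (f x)\<^sup>2 = 0"
      using integral_nonneg_eq_0_iff_AE[OF if2] by simp
    then have "AE x in \<nu>. f x * g x = 0" by eventually_elim simp
    then have "?I = 0" by (rule integral_eq_zero_AE)
    then show ?thesis by simp
  next
    case False
    then have A: "0 < ?A" by (simp add: less_le)
    have "0 \<le> (\<integral>x. (?A * g x - ?I * f x)\<^sup>2 \<partial>\<nu>)" by simp
    also have "\<dots> = (\<integral>x. ?A\<^sup>2 * (g x)\<^sup>2 - 2 * ?A * ?I * (f x * g x) + ?I\<^sup>2 * (f x)\<^sup>2 \<partial>\<nu>)"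
      by (rule Bochner_Integration.integral_cong[OF refl]) (simp add: power2_eq_square algebra_simps)
    also have "\<dots> = ?A\<^sup>2 * ?B - 2 * ?A * ?I * ?I + ?I\<^sup>2 * ?A"
      using if2 ig2 ifg by simp
    also have "\<dots> = ?A * (?A * ?B - ?I\<^sup>2)" by (simp add: power2_eq_square algebra_simps)
    finally show ?thesis using A by (simp add: zero_le_mult_iff)
  qed
  then have "sqrt (?I\<^sup>2) \<le> sqrt (?A * ?B)" by (rule real_sqrt_le_mono)
  then show ?thesis by (simp add: L2norm_def real_sqrt_mult)
qed

text \<open>The primitive of the truncation is \<open>clamp_at e x * x - (clamp_at e x)^2 / 2\<close>, a Huber function:
  among all \<open>\<tau>\<close> with \<open>\<bar>\<tau>\<bar> \<le> e\<close>, the truncation maximises \<open>\<tau> * x - \<tau>^2 / 2\<close>.\<close>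
definition clamp_at :: "real \<Rightarrow> real \<Rightarrow> real" where
  "clamp_at e x = max (- e) (min e x)"

definition huber :: "real \<Rightarrow> real \<Rightarrow> real" where
  "huber e x = clamp_at e x * x - (clamp_at e x)\<^sup>2 / 2"

lemma clamp_at_mono: "mono (clamp_at e)"
  by (auto simp: mono_def clamp_at_def)

lemma clamp_at_lipschitz: "\<bar>clamp_at e a - clamp_at e b\<bar> \<le> \<bar>a - b\<bar>"
  by (auto simp: clamp_at_def max_def min_def)

lemma abs_clamp_at_le: "0 \<le> e \<Longrightarrow> \<bar>clamp_at e a\<bar> \<le> e"
  by (auto simp: clamp_at_def)

text \<open>The truncation of \<open>x\<close> is the point of \<open>[- e, e]\<close> nearest to
  \<open>x\<close>, and \<open>\<tau> * x - \<tau>^2 / 2\<close> is half of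
  \<open>x^2 - (x - \<tau>)^2\<close>.\<close>

lemma huber_ge:
  assumes "\<bar>\<tau>\<bar> \<le> e"
  shows "\<tau> * x - \<tau>\<^sup>2 / 2 \<le> huber e x"
proof -
  have "\<bar>x - clamp_at e x\<bar> \<le> \<bar>x - \<tau>\<bar>"
    using assms unfolding clamp_at_def by linarith
  then have "(x - clamp_at e x)\<^sup>2 \<le> (x - \<tau>)\<^sup>2" by (simp add: abs_le_square_iff)
  then show ?thesis by (simp add: huber_def power2_diff algebra_simps)
qed

text \<open>The maximiser at \<open>b\<close> is a competitor at \<open>a\<close>.\<close>

lemma huber_subgradient:
  assumes "0 \<le> e"
  shows "huber e b - huber e a \<le> clamp_at e b * (b - a)"
  using huber_ge[OF abs_clamp_at_le[OF assms, of b], of a] by (simp add: huber_def algebra_simps)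

text \<open>The lower bounds test \<open>huber_ge\<close> at \<open>e\<close>, \<open>- e\<close>
  and 0. After division by \<open>e\<close>, the Huber function is within \<open>e / 2\<close> of
  the absolute value.\<close>

lemma huber_bounds:
  assumes "0 \<le> e"
  shows "e * \<bar>x\<bar> - e\<^sup>2 / 2 \<le> huber e x" "0 \<le> huber e x" "huber e x \<le> e * \<bar>x\<bar>"
proof -
  show "e * \<bar>x\<bar> - e\<^sup>2 / 2 \<le> huber e x"
    using huber_ge[of e e x] huber_ge[of "- e" e x] assms by (cases "0 \<le> x") auto
  show "0 \<le> huber e x" using huber_ge[of 0 e x] assms by simp
  have "clamp_at e x * x \<le> \<bar>clamp_at e x\<bar> * \<bar>x\<bar>" by (metis abs_ge_self abs_mult)
  also have "\<dots> \<le> e * \<bar>x\<bar>" by (intro mult_right_mono abs_clamp_at_le assms) simp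
  finally show "huber e x \<le> e * \<bar>x\<bar>"
    using zero_le_power2[of "clamp_at e x"] unfolding huber_def by linarith
qed

lemma clamp_at_measurable[measurable]: "clamp_at e \<in> borel_measurable borel"
  by (rule borel_measurable_mono[OF clamp_at_mono])

lemma huber_measurable[measurable]: "huber e \<in> borel_measurable borel"
  unfolding huber_def[abs_def] by measurable

section \<open>Decay of the distance to the mean\<close>

theorem theorem3p4:
  fixes M \<nu>1 \<nu>2 :: "'a measure" and m1 m2 :: "'a \<Rightarrow> 'a measure"
    and \<mu> u0 :: "'a \<Rightarrow> real" and u :: "real \<Rightarrow> 'a \<Rightarrow> real" and p c lam :: real
  assumes "p > 1"
    and "rw_space M m1 \<nu>1" and "reversible_rw M m1 \<nu>1"
    and "rw_space M m2 \<nu>2" and "reversible_rw M m2 \<nu>2"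
    and "\<mu> \<in> borel_measurable \<nu>1"
    and "\<nu>2 = density \<nu>1 (\<lambda>x. ennreal (\<mu> x))"
    and "\<exists>K. AE x in \<nu>1. \<mu> x \<le> K"
    and "c > 0" and "AE x in \<nu>1. \<mu> x \<ge> c"
    and "emeasure \<nu>1 (space \<nu>1) < \<infinity>"
    and "lam > 0"
    and "\<forall>v. integrable \<nu>1 v \<longrightarrow>
           ennreal (lam * (\<integral>x. \<bar>v x - mean \<nu>1 v\<bar> \<partial>\<nu>1)) \<le> F1 m1 \<nu>1 v"
    and "L2 \<nu>1 u0"
    and "strong_solution p m1 \<nu>1 m2 \<nu>2 \<mu> u0 u"
  shows "\<forall>t>0. (\<integral>x. \<bar>u t x - mean \<nu>1 u0\<bar> \<partial>\<nu>1)
                 \<le> 1 / (2 * lam) * (L2norm \<nu>1 u0)\<^sup>2 / t"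
proof (intro allI impI)
  fix t :: real assume t: "0 < t"
  note Poincare = assms(13)
  interpret finite_measure \<nu>1 using assms(11) by (intro finite_measureI) simp
  obtain K where K: "AE x in \<nu>1. \<mu> x \<le> K" using assms(8) by blast
  have pos: "AE x in \<nu>1. \<mu> x \<ge> 0" using assms(10) by eventually_elim (use assms(9) in linarith)
  obtain ut where ut: "(\<lambda>(t, x). ut t x) \<in> borel_measurable (lborel \<Otimes>\<^sub>M \<nu>1)"
    and en: "\<And>a b. 0 < a \<Longrightarrow> a \<le> b \<Longrightarrow>
           (\<integral>\<^sup>+ t. indicator {a..b} t * (\<integral>\<^sup>+ x. ennreal ((ut t x)\<^sup>2) \<partial>\<nu>1) \<partial>lborel) < \<infinity>"
    and inc: "\<And>s t. 0 < s \<Longrightarrow> s \<le> t \<Longrightarrow> AE x in \<nu>1. u t x - u s x = (LINT r:{s..t}|lborel. ut r x)"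
    and A: "AE t in lborel. 0 < t \<longrightarrow> opA p m1 \<nu>1 m2 \<nu>2 \<mu> (u t) (\<lambda>x. - ut t x)"
    and u: "\<And>t. 0 \<le> t \<Longrightarrow> L2 \<nu>1 (u t)"
    and cont: "\<And>t. 0 \<le> t \<Longrightarrow> ((\<lambda>s. L2norm \<nu>1 (\<lambda>x. u s x - u t x)) \<longlongrightarrow> 0) (at t within {0..})"
    and init: "AE x in \<nu>1. u 0 x = u0 x"
    using assms(15) unfolding strong_solution_def by auto
  note opA_dissipation' = opA_dissipation[OF assms(1,4,5,6,7) K pos assms(11)]
  \<comment> \<open>The rate \<open>C\<close> may be any lower bound on \<open>[a, b]\<close> for
    the drop of \<open>F1\<close> from \<open>u r\<close> to \<open>u r - T (u r)\<close>. The start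
    \<open>a\<close> is positive because the energy of \<open>ut\<close> is controlled only away
    from time 0.\<close>
  have estimate: "(\<integral>x. j (u b x) \<partial>\<nu>1) + C * (b - a) \<le> (\<integral>x. j (u a x) \<partial>\<nu>1)"
    if ab: "0 < a" "a \<le> b" and T: "mono T" and lip: "\<And>a b. \<bar>T a - T b\<bar> \<le> \<bar>a - b\<bar>"
      and Tu: "\<And>r. 0 < r \<Longrightarrow> L2 \<nu>1 (\<lambda>x. T (u r x))"
      and ju: "\<And>r. 0 < r \<Longrightarrow> integrable \<nu>1 (\<lambda>x. j (u r x))"
      and jT: "\<And>a b. j b - j a \<le> T b * (b - a)"
      and C: "\<And>r. a \<le> r \<Longrightarrow> r \<le> b \<Longrightarrow> F1 m1 \<nu>1 (u r) < \<infinity> \<Longrightarrow>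
        F1 m1 \<nu>1 (\<lambda>x. u r x - T (u r x)) \<le> F1 m1 \<nu>1 (u r) \<Longrightarrow>
        C \<le> enn2real (F1 m1 \<nu>1 (u r)) - enn2real (F1 m1 \<nu>1 (\<lambda>x. u r x - T (u r x)))"
    for a b C :: real and T j :: "real \<Rightarrow> real"
  proof (rule evolution_estimate[where T = T and ut = ut and u = u, OF finite_measure_axioms ut])
    show "AE r in lborel. a \<le> r \<longrightarrow> r \<le> b \<longrightarrow> L2 \<nu>1 (ut r) \<and> (\<integral>x. T (u r x) * ut r x \<partial>\<nu>1) \<le> - C"
      using A
    proof (eventually_elim, intro impI conjI)
      fix r assume "0 < r \<longrightarrow> opA p m1 \<nu>1 m2 \<nu>2 \<mu> (u r) (\<lambda>x. - ut r x)" and r: "a \<le> r" "r \<le> b"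
      then have o: "opA p m1 \<nu>1 m2 \<nu>2 \<mu> (u r) (\<lambda>x. - ut r x)" and r0: "0 < r" using ab by auto
      show "L2 \<nu>1 (ut r)" using o L2_uminus[of \<nu>1 "\<lambda>x. - ut r x"] by (simp add: opA_def)
      note D = opA_dissipation'[OF o T lip Tu[OF r0]]
      show "(\<integral>x. T (u r x) * ut r x \<partial>\<nu>1) \<le> - C" using D(1) C[OF r D(3,2)] by linarith
    qed
  qed (use ab lip Tu ju jT en inc u in auto)
  \<comment> \<open>The drop of \<open>F1\<close> is never negative, so the rate 0 is always
    admissible.\<close>
  have dissipates: "(\<integral>x. j (u b x) \<partial>\<nu>1) \<le> (\<integral>x. j (u a x) \<partial>\<nu>1)"
    if "0 < a" "a \<le> b" "mono T" "\<And>a b. \<bar>T a - T b\<bar> \<le> \<bar>a - b\<bar>"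
      "\<And>r. 0 < r \<Longrightarrow> L2 \<nu>1 (\<lambda>x. T (u r x))" "\<And>r. 0 < r \<Longrightarrow> integrable \<nu>1 (\<lambda>x. j (u r x))"
      "\<And>a b. j b - j a \<le> T b * (b - a)"
    for a b :: real and T j :: "real \<Rightarrow> real"
    using estimate[OF that, where C = 0] by (simp add: enn2real_mono)
  have ui: "integrable \<nu>1 (u r)" if "0 \<le> r" for r by (rule L2_integrable[OF u[OF that]])
  \<comment> \<open>Estimates start at positive times; continuity at 0 carries them down to the
    initial datum.\<close>
  have D0: "((\<lambda>s. L2norm \<nu>1 (\<lambda>x. u s x - u 0 x)) \<longlongrightarrow> 0) (at_right 0)"
    by (rule tendsto_within_subset[OF cont]) auto
  have ev: "\<forall>\<^sub>F s in at_right 0. 0 < s \<and> s < b" if "0 < b" for b :: real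
    using eventually_at_right_real[OF that] by eventually_elim auto

  \<comment> \<open>Constants are nondecreasing whatever their sign, so \<open>1\<close> and
    \<open>- 1\<close> give opposite inequalities.\<close>
  have mass_step: "(\<integral>x. u b x \<partial>\<nu>1) = (\<integral>x. u a x \<partial>\<nu>1)" if "0 < a" "a \<le> b" for a b
  proof (rule antisym)
    show "(\<integral>x. u b x \<partial>\<nu>1) \<le> (\<integral>x. u a x \<partial>\<nu>1)"
      by (rule dissipates[where T = "\<lambda>_. 1" and j = "\<lambda>a. a", OF that])
        (auto simp: ui L2_def mono_def)
    have "(\<integral>x. - u b x \<partial>\<nu>1) \<le> (\<integral>x. - u a x \<partial>\<nu>1)"
      by (rule dissipates[where T = "\<lambda>_. - 1" and j = "\<lambda>a. - a", OF that])
        (auto simp: ui L2_def mono_def)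
    then show "(\<integral>x. u a x \<partial>\<nu>1) \<le> (\<integral>x. u b x \<partial>\<nu>1)" by simp
  qed
  have mass: "(\<integral>x. u b x \<partial>\<nu>1) = (\<integral>x. u0 x \<partial>\<nu>1)" if b: "0 < b" for b
  proof -
    \<comment> \<open>The mass at \<open>b\<close> equals that at any \<open>s\<close> in between;
      Cauchy-Schwarz against the constant 1 compares the latter with the mass at 0.\<close>
    have "\<bar>(\<integral>x. u b x \<partial>\<nu>1) - (\<integral>x. u 0 x \<partial>\<nu>1)\<bar> \<le> L2norm \<nu>1 (\<lambda>_. 1) * 0"
    proof (rule tendsto_lowerbound)
      show "((\<lambda>s. L2norm \<nu>1 (\<lambda>_. 1) * L2norm \<nu>1 (\<lambda>x. u s x - u 0 x)) \<longlongrightarrow> L2norm \<nu>1 (\<lambda>_. 1) * 0) (at_right 0)"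
        by (intro tendsto_intros D0)
      show "\<forall>\<^sub>F s in at_right 0. \<bar>(\<integral>x. u b x \<partial>\<nu>1) - (\<integral>x. u 0 x \<partial>\<nu>1)\<bar>
          \<le> L2norm \<nu>1 (\<lambda>_. 1) * L2norm \<nu>1 (\<lambda>x. u s x - u 0 x)"
        using ev[OF b]
      proof eventually_elim
        case (elim s)
        have "L2 \<nu>1 (\<lambda>_. 1)" by (simp add: L2_def)
        from L2_Cauchy_Schwarz[OF this L2_diff[OF u u], of s 0] show ?case
          using elim mass_step[of s b] by (simp add: ui)
      qed
    qed simp
    then have "(\<integral>x. u b x \<partial>\<nu>1) = (\<integral>x. u 0 x \<partial>\<nu>1)" by simp
    also have "\<dots> = (\<integral>x. u0 x \<partial>\<nu>1)"
      by (rule integral_cong_AE) (use u[of 0] assms(14) init in \<open>auto simp: L2_def\<close>)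
    finally show ?thesis .
  qed
  define k where "k = mean \<nu>1 u0"
  \<comment> \<open>Hence the Poincare inequality at every positive time measures the distance to
    the same constant.\<close>
  have mean: "mean \<nu>1 (u r) = k" if "0 < r" for r
    using mass[OF that] by (simp add: k_def mean_def)
  have uk: "integrable \<nu>1 (\<lambda>x. \<bar>u r x - k\<bar>)" if "0 \<le> r" for r using ui[OF that] by simp

  have L1_decreasing: "(\<integral>x. \<bar>u b x - k\<bar> \<partial>\<nu>1) \<le> (\<integral>x. \<bar>u a x - k\<bar> \<partial>\<nu>1)"
    if ab: "0 < a" "a \<le> b" for a b
  proof -
    let ?V = "measure \<nu>1 (space \<nu>1)"
    \<comment> \<open>Use the truncation at level \<open>e\<close> centred at \<open>k\<close>. Its
      Huber primitive differs from \<open>e\<close> times the distance to \<open>k\<close> by at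
      most \<open>e^2 / 2\<close>; integrating over total mass \<open>?V\<close> and dividing by
      \<open>e\<close> leaves the error \<open>e * ?V / 2\<close>.\<close>
    have *: "(\<integral>x. \<bar>u b x - k\<bar> \<partial>\<nu>1) \<le> (\<integral>x. \<bar>u a x - k\<bar> \<partial>\<nu>1) + e * ?V / 2" if e: "0 < e" for e
    proof -
      have e0: "0 \<le> e" using e by simp
      have hi: "integrable \<nu>1 (\<lambda>x. huber e (u r x - k))" if "0 < r" for r
      proof (rule Bochner_Integration.integrable_bound)
        show "integrable \<nu>1 (\<lambda>x. e * \<bar>u r x - k\<bar>)" using uk[of r] that by simp
        show "(\<lambda>x. huber e (u r x - k)) \<in> borel_measurable \<nu>1"
          using L2_measurable[OF u[of r]] that by simp
        show "AE x in \<nu>1. norm (huber e (u r x - k)) \<le> norm (e * \<bar>u r x - k\<bar>)"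
          using huber_bounds(2,3)[OF e0] e by (intro AE_I2) (simp add: abs_mult)
      qed
      have b0: "0 < b" using ab by simp
      have "e * (\<integral>x. \<bar>u b x - k\<bar> \<partial>\<nu>1) - e\<^sup>2 / 2 * ?V = (\<integral>x. e * \<bar>u b x - k\<bar> - e\<^sup>2 / 2 \<partial>\<nu>1)"
        using uk[of b] b0 by simp
      also have "\<dots> \<le> (\<integral>x. huber e (u b x - k) \<partial>\<nu>1)"
        using uk[of b] b0 by (intro integral_mono hi huber_bounds e0) auto
      also have "\<dots> \<le> (\<integral>x. huber e (u a x - k) \<partial>\<nu>1)"
      proof (rule dissipates[where T = "\<lambda>a. clamp_at e (a - k)" and j = "\<lambda>a. huber e (a - k)", OF ab])
        show "mono (\<lambda>a. clamp_at e (a - k))"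
          using clamp_at_mono[of e] by (auto simp: mono_def)
        show "\<bar>clamp_at e (a - k) - clamp_at e (b - k)\<bar> \<le> \<bar>a - b\<bar>" for a b
          using clamp_at_lipschitz[of e "a - k" "b - k"] by simp
        show "huber e (b - k) - huber e (a - k) \<le> clamp_at e (b - k) * (b - a)" for a b
          using huber_subgradient[OF e0, of "b - k" "a - k"] by simp
        show "L2 \<nu>1 (\<lambda>x. clamp_at e (u r x - k))" if "0 < r" for r
          using L2_measurable[OF u[of r]] that by (intro L2_bounded[OF _ abs_clamp_at_le[OF e0]]) simp
      qed (rule hi)
      also have "\<dots> \<le> (\<integral>x. e * \<bar>u a x - k\<bar> \<partial>\<nu>1)"
        using uk[of a] ab by (intro integral_mono hi huber_bounds e0) auto
      also have "\<dots> = e * (\<integral>x. \<bar>u a x - k\<bar> \<partial>\<nu>1)" by simp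
      finally have "e * (\<integral>x. \<bar>u b x - k\<bar> \<partial>\<nu>1) \<le> e * ((\<integral>x. \<bar>u a x - k\<bar> \<partial>\<nu>1) + e * ?V / 2)"
        by (simp add: power2_eq_square algebra_simps)
      then show ?thesis using e by simp
    qed
    have "((\<lambda>e. (\<integral>x. \<bar>u a x - k\<bar> \<partial>\<nu>1) + e * ?V / 2) \<longlongrightarrow> (\<integral>x. \<bar>u a x - k\<bar> \<partial>\<nu>1) + 0 * ?V / 2) (at_right 0)"
      by (intro tendsto_intros) auto
    then have "(\<integral>x. \<bar>u b x - k\<bar> \<partial>\<nu>1) \<le> (\<integral>x. \<bar>u a x - k\<bar> \<partial>\<nu>1) + 0 * ?V / 2"
    proof (rule tendsto_lowerbound)
      show "\<forall>\<^sub>F e in at_right 0. (\<integral>x. \<bar>u b x - k\<bar> \<partial>\<nu>1) \<le> (\<integral>x. \<bar>u a x - k\<bar> \<partial>\<nu>1) + e * ?V / 2"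
        using ev[of 1] by (auto elim!: eventually_mono intro: *)
    qed simp
    then show ?thesis by simp
  qed

  \<comment> \<open>By \<open>L1_decreasing\<close> this bounds \<open>lam\<close> times the
    distance to \<open>k\<close> from below at all positive times up to \<open>t\<close>.\<close>
  define C where "C = lam * (\<integral>x. \<bar>u t x - k\<bar> \<partial>\<nu>1)"
  have energy: "(L2norm \<nu>1 (u t))\<^sup>2 / 2 + C * (t - s) \<le> (L2norm \<nu>1 (u s))\<^sup>2 / 2" if s: "0 < s" "s \<le> t" for s
  proof -
    have "(\<integral>x. (u t x)\<^sup>2 / 2 \<partial>\<nu>1) + C * (t - s) \<le> (\<integral>x. (u s x)\<^sup>2 / 2 \<partial>\<nu>1)"
    \<comment> \<open>For the identity, \<open>u r - T (u r)\<close> is 0 and so is its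
      \<open>F1\<close>: the drop is all of \<open>F1 m1 \<nu>1 (u r)\<close>, which the Poincare
      inequality bounds below by \<open>C\<close>.\<close>
    proof (rule estimate[where T = "\<lambda>a. a" and j = "\<lambda>a. a\<^sup>2 / 2", OF s])
      show "b\<^sup>2 / 2 - a\<^sup>2 / 2 \<le> b * (b - a)" for a b :: real
        using sum_squares_bound[of a b] by (simp add: power2_eq_square algebra_simps)
      fix r assume r: "s \<le> r" "r \<le> t" and fin: "F1 m1 \<nu>1 (u r) < \<infinity>"
      have r0: "0 < r" using r s by simp
      have "ennreal (lam * (\<integral>x. \<bar>u r x - k\<bar> \<partial>\<nu>1)) \<le> F1 m1 \<nu>1 (u r)"
        using Poincare ui[of r] r0 mean[OF r0] by auto
      then have "enn2real (ennreal (lam * (\<integral>x. \<bar>u r x - k\<bar> \<partial>\<nu>1))) \<le> enn2real (F1 m1 \<nu>1 (u r))"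
        using fin by (intro enn2real_mono) auto
      then have "lam * (\<integral>x. \<bar>u r x - k\<bar> \<partial>\<nu>1) \<le> enn2real (F1 m1 \<nu>1 (u r))"
        using assms(12) by simp
      moreover have "C \<le> lam * (\<integral>x. \<bar>u r x - k\<bar> \<partial>\<nu>1)"
        unfolding C_def using assms(12) by (intro mult_left_mono L1_decreasing r0 r) simp
      ultimately show "C \<le> enn2real (F1 m1 \<nu>1 (u r)) - enn2real (F1 m1 \<nu>1 (\<lambda>x. u r x - u r x))"
        by (simp add: F1_def)
    qed (use u in \<open>auto simp: mono_def L2_def\<close>)
    then show ?thesis by (simp add: L2norm_power2)
  qed
  \<comment> \<open>Let \<open>s\<close> tend to 0 in \<open>energy\<close>, dropping the norm at
    time \<open>t\<close>. Expanding \<open>u s\<close> around \<open>u 0\<close>, Cauchy-Schwarz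
    bounds its squared norm by terms that converge by \<open>D0\<close>.\<close>
  have "C * (t - 0) \<le> ((L2norm \<nu>1 (u 0))\<^sup>2 + 2 * (L2norm \<nu>1 (u 0) * 0) + 0\<^sup>2) / 2"
  proof (rule tendsto_le[OF trivial_limit_at_right_real])
    show "((\<lambda>s. ((L2norm \<nu>1 (u 0))\<^sup>2 + 2 * (L2norm \<nu>1 (u 0) * L2norm \<nu>1 (\<lambda>x. u s x - u 0 x))
        + (L2norm \<nu>1 (\<lambda>x. u s x - u 0 x))\<^sup>2) / 2)
      \<longlongrightarrow> ((L2norm \<nu>1 (u 0))\<^sup>2 + 2 * (L2norm \<nu>1 (u 0) * 0) + 0\<^sup>2) / 2) (at_right 0)"
      by (intro tendsto_intros D0) auto
    show "((\<lambda>s. C * (t - s)) \<longlongrightarrow> C * (t - 0)) (at_right 0)" by (intro tendsto_intros)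
    show "\<forall>\<^sub>F s in at_right 0. C * (t - s) \<le> ((L2norm \<nu>1 (u 0))\<^sup>2
        + 2 * (L2norm \<nu>1 (u 0) * L2norm \<nu>1 (\<lambda>x. u s x - u 0 x))
        + (L2norm \<nu>1 (\<lambda>x. u s x - u 0 x))\<^sup>2) / 2"
      using ev[OF t]
    proof eventually_elim
      case (elim s)
      let ?d = "\<lambda>x. u s x - u 0 x"
      have L: "L2 \<nu>1 (u 0)" "L2 \<nu>1 ?d" using u elim by (auto intro!: L2_diff)
      have "(\<integral>x. (u s x)\<^sup>2 \<partial>\<nu>1) = (\<integral>x. (u 0 x)\<^sup>2 + 2 * (u 0 x * ?d x) + (?d x)\<^sup>2 \<partial>\<nu>1)"
        by (rule Bochner_Integration.integral_cong[OF refl]) (simp add: power2_eq_square algebra_simps)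
      also have "\<dots> = (\<integral>x. (u 0 x)\<^sup>2 \<partial>\<nu>1) + 2 * (\<integral>x. u 0 x * ?d x \<partial>\<nu>1) + (\<integral>x. (?d x)\<^sup>2 \<partial>\<nu>1)"
      proof -
        have "integrable \<nu>1 (\<lambda>x. (u 0 x)\<^sup>2)" "integrable \<nu>1 (\<lambda>x. (?d x)\<^sup>2)"
          "integrable \<nu>1 (\<lambda>x. 2 * (u 0 x * ?d x))"
          using L L2_mult_integrable[OF L] by (auto simp: L2_def)
        then show ?thesis by simp
      qed
      finally have "(L2norm \<nu>1 (u s))\<^sup>2 = (L2norm \<nu>1 (u 0))\<^sup>2 + 2 * (\<integral>x. u 0 x * ?d x \<partial>\<nu>1) + (L2norm \<nu>1 ?d)\<^sup>2"
        by (simp add: L2norm_power2)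
      then show ?case
        using energy[of s] elim L2_Cauchy_Schwarz[OF L] zero_le_power2[of "L2norm \<nu>1 (u t)"] by argo
    qed
  qed
  also have "L2norm \<nu>1 (u 0) = L2norm \<nu>1 u0"
    unfolding L2norm_def
    by (intro arg_cong[where f = sqrt] integral_cong_AE)
      (use u[of 0] assms(14) init in \<open>auto simp: L2_def\<close>)
  finally have "lam * (\<integral>x. \<bar>u t x - k\<bar> \<partial>\<nu>1) * t \<le> (L2norm \<nu>1 u0)\<^sup>2 / 2"
    by (simp add: C_def)
  then show "(\<integral>x. \<bar>u t x - mean \<nu>1 u0\<bar> \<partial>\<nu>1) \<le> 1 / (2 * lam) * (L2norm \<nu>1 u0)\<^sup>2 / t"
    using t assms(12) by (simp add: k_def field_simps)
qed

end
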